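(* Let $V$ be a finite-dimensional complex vector space and $T\in\operatorname{End}(V)$. For each distinct eigenvalue $\lambda$ of $T$, let $\Delta^\lambda$ be the associated sequence of block increments. Then the lattice of orbits of the centralizer group $C(T)$ on $V$ is isomorphic to the Cartesian lattice product $$\prod_{\lambda\in\mathrm{Spec}(T)}\Gamma_{\Delta^\lambda}.$$
   Context: $C(T)=\{U\in\operatorname{GL}(V): UT=TU\}$ is the centralizer group of $T$, acting on $V$; $\mathrm{Spec}(T)$ is the set of distinct eigenvalues of $T$. The algebra of all operators commuting with $T$ is $\mathfrak{c}(T)=\{U\in\operatorname{End}(V):UT=TU\}$. Orbit closure $\mathcal{O}\mapsto\overline{\mathcal{O}}$ identifies the set of $C(T)$-orbits in $V$ with the set of $\mathfrak{c}(T)$-invariant subspaces of $V$; the latter is a lattice under sum and intersection (ordered by inclusion), and the lattice of orbits carries the corresponding order: $\mathcal{O}\le\mathcal{O}'$ if and only if $\overline{\mathcal{O}}\subseteq\overline{\mathcal{O}'}$. Block increments: for an eigenvalue $\lambda$, let $B=\{i_1<i_2<\cdots\}\subset\{1,2,\ldots\}$ be the (finite) set of sizes of Jordan blocks of $T$ with eigenvalue $\lambda$ (a set, without multiplicities). The sequence of block increments $\Delta^\lambda=(\Delta_k)$, $1\le k\le \#B$, is $\Delta_1=i_1$ and $\Delta_k=i_k-i_{k-1}$ for $k>1$. The poset $\Gamma_\Delta$: for a sequence $\Delta=(\Delta_k)$ of natural numbers, let $[\Delta_k]=\{0,1,\ldots,\Delta_k\}$ and $\Gamma_\Delta=\prod_k[\Delta_k]$,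 partially ordered by: for $r=(r_i)$ and $s=(s_i)$ in $\Gamma_\Delta$, $r\le s$ if and only if $\sum_{i\le k}r_i\le\sum_{i\le k}s_i$ for all $k$. The Cartesian product of lattices has the componentwise order. *)

theory Defs
  imports
    "HOL-Analysis.Analysis"
    "HOL-Algebra.Lattice"
    "HOL-Algebra.Group_Action"
    "Jordan_Normal_Form.Jordan_Normal_Form_Existence"
begin

section \<open>Orders and lattices\<close>

definition lattice_isomorphic :: "('a, 'c) gorder_scheme \<Rightarrow> ('b, 'd) gorder_scheme \<Rightarrow> bool" where
  "lattice_isomorphic L M \<longleftrightarrow> lattice L \<and> lattice M \<and>
     (\<exists>f. bij_betw f (carrier L) (carrier M) \<and> join_pres L M f \<and> meet_pres L M f)"

definition product_gorder :: "'i set \<Rightarrow> ('i \<Rightarrow> 'a gorder) \<Rightarrow> ('i \<Rightarrow> 'a) gorder" where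
  "product_gorder I L =
     \<lparr> carrier = (\<Pi>\<^sub>E i\<in>I. carrier (L i)),
       eq = (=),
       le = (\<lambda>f g. \<forall>i\<in>I. f i \<sqsubseteq>\<^bsub>L i\<^esub> g i) \<rparr>"

text \<open>The sequence \<open>\<Delta>\<close> is a list, so its indices start at 0; the elements of
  \<open>\<Gamma>\<close> are functions that are \<open>undefined\<close> outside the index set.\<close>

definition Gamma_order :: "nat list \<Rightarrow> (nat \<Rightarrow> nat) gorder" where
  "Gamma_order \<Delta> =
     \<lparr> carrier = (\<Pi>\<^sub>E k\<in>{..<length \<Delta>}. {0..\<Delta> ! k}),
       eq = (=),
       le = (\<lambda>r s. \<forall>k<length \<Delta>. (\<Sum>i\<le>k. r i) \<le> (\<Sum>i\<le>k. s i)) \<rparr>"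


section \<open>Eigenvalues and Jordan blocks of an operator\<close>

definition operator_spectrum ::
    "(complex \<Rightarrow> 'v \<Rightarrow> 'v) \<Rightarrow> ('v::ab_group_add \<Rightarrow> 'v) \<Rightarrow> complex set" where
  "operator_spectrum smul T = {\<mu>. \<exists>v. v \<noteq> 0 \<and> T v = smul \<mu> v}"

definition ordered_basis :: "(complex \<Rightarrow> 'v \<Rightarrow> 'v) \<Rightarrow> 'v::ab_group_add list \<Rightarrow> bool" where
  "ordered_basis smul bs \<longleftrightarrow>
     distinct bs \<and> \<not> Modules.module.dependent smul (set bs) \<and> Modules.module.span smul (set bs) = UNIV"

definition operator_mat ::
    "(complex \<Rightarrow> 'v \<Rightarrow> 'v) \<Rightarrow> 'v::ab_group_add list \<Rightarrow> ('v \<Rightarrow> 'v) \<Rightarrow> complex mat" where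
  "operator_mat smul bs T =
     mat (length bs) (length bs)
       (\<lambda>(i, j). Modules.module.representation smul (set bs) (T (bs ! j)) (bs ! i))"

text \<open>The Jordan normal form is unique up to the order of the blocks and does not depend on the
  basis, so the existential quantifiers do not collect sizes from different forms.\<close>

definition jordan_block_sizes ::
    "(complex \<Rightarrow> 'v \<Rightarrow> 'v) \<Rightarrow> ('v::ab_group_add \<Rightarrow> 'v) \<Rightarrow> complex \<Rightarrow> nat set" where
  "jordan_block_sizes smul T \<mu> =
     {m. \<exists>bs n_as. ordered_basis smul bs \<and> jordan_nf (operator_mat smul bs T) n_as \<and>
                   (m, \<mu>) \<in> set n_as}"

definition increments :: "nat list \<Rightarrow> nat list" where
  "increments ms = map (\<lambda>k. if k = 0 then ms ! 0 else ms ! k - ms ! (k - 1)) [0..<length ms]"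

definition block_increments ::
    "(complex \<Rightarrow> 'v \<Rightarrow> 'v) \<Rightarrow> ('v::ab_group_add \<Rightarrow> 'v) \<Rightarrow> complex \<Rightarrow> nat list" where
  "block_increments smul T \<mu> = increments (sorted_list_of_set (jordan_block_sizes smul T \<mu>))"


section \<open>Orbits of the centralizer group\<close>

definition centralizer_group ::
    "(complex \<Rightarrow> 'v \<Rightarrow> 'v) \<Rightarrow> ('v::ab_group_add \<Rightarrow> 'v) \<Rightarrow> ('v \<Rightarrow> 'v) monoid" where
  "centralizer_group smul T =
     \<lparr> carrier = {U. Vector_Spaces.linear smul smul U \<and> bij U \<and> U \<circ> T = T \<circ> U},
       mult = (\<circ>),
       one = id \<rparr>"

text \<open>The coarsest topology for which all linear functionals are continuous. On a
  finite-dimensional space it is the usual Euclidean topology, transported from \<open>\<complex>\<^sup>n\<close> by any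
  choice of coordinates.\<close>

definition vector_topology :: "(complex \<Rightarrow> 'v \<Rightarrow> 'v) \<Rightarrow> 'v::ab_group_add topology" where
  "vector_topology smul =
     topology_generated_by {f -` W | f W. Vector_Spaces.linear smul (*) f \<and> open W}"

definition orbit_lattice ::
    "(complex \<Rightarrow> 'v \<Rightarrow> 'v) \<Rightarrow> ('v::ab_group_add \<Rightarrow> 'v) \<Rightarrow> 'v set gorder" where
  "orbit_lattice smul T =
     \<lparr> carrier = orbits (centralizer_group smul T) UNIV (\<lambda>U. U),
       eq = (=),
       le = (\<lambda>A B. vector_topology smul closure_of A \<subseteq> vector_topology smul closure_of B) \<rparr>"

end

theory Submission
  imports Defs
begin

text \<open>For an eigenvalue \<open>\<mu>\<close> put \<open>N = T - \<mu>\<close> and let \<open>depth \<mu> m v\<close> be the least \<open>c\<close> such that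
  \<open>N\<^sup>c v\<close> lies in the range of \<open>N\<^sup>m\<close>. Operators commuting with \<open>T\<close> do not increase the depth, and
  a computation in Jordan chains shows that \<open>v\<close> lies in \<open>c(T) w\<close> as soon as
  \<open>depth \<mu> m v \<le> depth \<mu> m w\<close> for all eigenvalues \<open>\<mu>\<close> and block sizes \<open>m\<close>. If \<open>m\<^sub>1 < m\<^sub>2 < \<dots>\<close>
  are the block sizes for \<open>\<mu>\<close>, then \<open>depth \<mu> m\<^sub>1 v, depth \<mu> m\<^sub>2 v, \<dots>\<close> is the sequence of partial
  sums of an element of \<open>\<Gamma>\<^sub>\<Delta>\<close>, and all elements of the product of the \<open>\<Gamma>\<^sub>\<Delta>\<close> arise.
  Since invertible operators are generic in \<open>c(T)\<close>, the closure of the orbit of \<open>w\<close> is \<open>c(T) w\<close>, and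
  two vectors with \<open>c(T) v = c(T) w\<close> lie in the same orbit.\<close>

section \<open>Lattices of bounded partial sums\<close>

lemma least_Upper_pair_iff:
  assumes "x \<in> carrier L" "y \<in> carrier L"
  shows "least L s (Upper L {x, y}) \<longleftrightarrow>
    s \<in> carrier L \<and> x \<sqsubseteq>\<^bsub>L\<^esub> s \<and> y \<sqsubseteq>\<^bsub>L\<^esub> s \<and>
    (\<forall>u\<in>carrier L. x \<sqsubseteq>\<^bsub>L\<^esub> u \<longrightarrow> y \<sqsubseteq>\<^bsub>L\<^esub> u \<longrightarrow> s \<sqsubseteq>\<^bsub>L\<^esub> u)"
  using assms by (auto simp: least_def Upper_def)

lemma greatest_Lower_pair_iff:
  assumes "x \<in> carrier L" "y \<in> carrier L"
  shows "greatest L s (Lower L {x, y}) \<longleftrightarrow>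
    s \<in> carrier L \<and> s \<sqsubseteq>\<^bsub>L\<^esub> x \<and> s \<sqsubseteq>\<^bsub>L\<^esub> y \<and>
    (\<forall>u\<in>carrier L. u \<sqsubseteq>\<^bsub>L\<^esub> x \<longrightarrow> u \<sqsubseteq>\<^bsub>L\<^esub> y \<longrightarrow> u \<sqsubseteq>\<^bsub>L\<^esub> s)"
  using assms by (auto simp: greatest_def Lower_def)

text \<open>Least upper and greatest lower bounds of pairs are described by the order alone, so they
  pull back along an order isomorphism \<open>f\<close>. This makes \<open>L\<close> a lattice and
  \<open>f\<close> compatible with joins and meets.\<close>

lemma lattice_isomorphicI:
  assumes M: "Lattice.lattice M"
    and eq: "\<And>x y. x .=\<^bsub>L\<^esub> y \<longleftrightarrow> x = y"
    and bij: "bij_betw f (carrier L) (carrier M)"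
    and le: "\<And>x y. \<lbrakk>x \<in> carrier L; y \<in> carrier L\<rbrakk> \<Longrightarrow> x \<sqsubseteq>\<^bsub>L\<^esub> y \<longleftrightarrow> f x \<sqsubseteq>\<^bsub>M\<^esub> f y"
  shows "lattice_isomorphic L M"
proof -
  interpret M: Lattice.lattice M by (rule M)
  have img: "f ` carrier L = carrier M" and inj: "inj_on f (carrier L)"
    using bij by (auto simp: bij_betw_def)
  have fc: "f x \<in> carrier M" if "x \<in> carrier L" for x using img that by blast
  interpret po: partial_order L
  proof
    show "x .=\<^bsub>L\<^esub> y" if "x \<sqsubseteq>\<^bsub>L\<^esub> y" "y \<sqsubseteq>\<^bsub>L\<^esub> x" "x \<in> carrier L" "y \<in> carrier L" for x y
    proof -
      have "f x = f y" using that le fc by (auto intro: M.le_antisym)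
      then show ?thesis using that inj by (auto simp: eq dest: inj_onD)
    qed
    show "x \<sqsubseteq>\<^bsub>L\<^esub> z"
      if "x \<sqsubseteq>\<^bsub>L\<^esub> y" "y \<sqsubseteq>\<^bsub>L\<^esub> z" "x \<in> carrier L" "y \<in> carrier L" "z \<in> carrier L" for x y z
      using that le fc M.le_trans by metis
  qed (auto simp: eq le fc fun_eq_iff)
  have least_iff: "least L s (Upper L {x, y}) \<longleftrightarrow> s \<in> carrier L \<and> least M (f s) (Upper M {f x, f y})"
    if xy: "x \<in> carrier L" "y \<in> carrier L" for s x y
    by (simp add: least_Upper_pair_iff xy fc le img[symmetric] cong: conj_cong)
  have greatest_iff: "greatest L s (Lower L {x, y}) \<longleftrightarrow> s \<in> carrier L \<and> greatest M (f s) (Lower M {f x, f y})"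
    if xy: "x \<in> carrier L" "y \<in> carrier L" for s x y
    by (simp add: greatest_Lower_pair_iff xy fc le img[symmetric] cong: conj_cong)
  have L: "Lattice.lattice L"
  proof
    fix x y assume xy: "x \<in> carrier L" "y \<in> carrier L"
    obtain s where s: "least M s (Upper M {f x, f y})"
      using M.sup_of_two_exists fc xy by blast
    then have "s \<in> carrier M" by (auto simp: least_def Upper_def)
    then show "\<exists>s. least L s (Upper L {x, y})"
      using s least_iff[OF xy] img by (metis imageE)
    obtain s where s: "greatest M s (Lower M {f x, f y})"
      using M.inf_of_two_exists fc xy by blast
    then have "s \<in> carrier M" by (auto simp: greatest_def Lower_def)
    then show "\<exists>s. greatest L s (Lower L {x, y})"
      using s greatest_iff[OF xy] img by (metis imageE)
  qed
  interpret L: Lattice.lattice L by (rule L)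
  have "f (x \<squnion>\<^bsub>L\<^esub> y) = f x \<squnion>\<^bsub>M\<^esub> f y" if xy: "x \<in> carrier L" "y \<in> carrier L" for x y
  proof -
    \<comment> \<open>A join is a Hilbert choice of a least upper bound; uniqueness in
      \<open>M\<close> identifies the two choices.\<close>
    have "least L (x \<squnion>\<^bsub>L\<^esub> y) (Upper L {x, y})"
      using L.sup_of_two_exists[OF xy] unfolding join_def Lattice.sup_def by (rule someI_ex)
    then have "least M (f (x \<squnion>\<^bsub>L\<^esub> y)) (Upper M {f x, f y})" using least_iff[OF xy] by blast
    moreover have "least M (f x \<squnion>\<^bsub>M\<^esub> f y) (Upper M {f x, f y})"
      using M.sup_of_two_exists[OF fc[OF xy(1)] fc[OF xy(2)]]
      unfolding join_def Lattice.sup_def by (rule someI_ex)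
    ultimately show ?thesis by (rule M.least_unique)
  qed
  moreover have "f (x \<sqinter>\<^bsub>L\<^esub> y) = f x \<sqinter>\<^bsub>M\<^esub> f y" if xy: "x \<in> carrier L" "y \<in> carrier L" for x y
  proof -
    have "greatest L (x \<sqinter>\<^bsub>L\<^esub> y) (Lower L {x, y})"
      using L.inf_of_two_exists[OF xy] unfolding meet_def Lattice.inf_def by (rule someI_ex)
    then have "greatest M (f (x \<sqinter>\<^bsub>L\<^esub> y)) (Lower M {f x, f y})" using greatest_iff[OF xy] by blast
    moreover have "greatest M (f x \<sqinter>\<^bsub>M\<^esub> f y) (Lower M {f x, f y})"
      using M.inf_of_two_exists[OF fc[OF xy(1)] fc[OF xy(2)]]
      unfolding meet_def Lattice.inf_def by (rule someI_ex)
    ultimately show ?thesis by (rule M.greatest_unique)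
  qed
  ultimately show ?thesis
    using L M bij unfolding lattice_isomorphic_def join_pres_def meet_pres_def by blast
qed

lemma lattice_product_gorder:
  assumes "\<And>i. i \<in> I \<Longrightarrow> Lattice.lattice (L i)"
  shows "Lattice.lattice (product_gorder I L)"
proof -
  have po: "partial_order (L i)" if "i \<in> I" for i
    using assms[OF that] by (simp add: Lattice.lattice_def upper_semilattice_def)
  interpret partial_order "product_gorder I L"
  proof
    fix x y z
    assume "x \<sqsubseteq>\<^bsub>product_gorder I L\<^esub> y" "y \<sqsubseteq>\<^bsub>product_gorder I L\<^esub> z"
      "x \<in> carrier (product_gorder I L)" "y \<in> carrier (product_gorder I L)"
      "z \<in> carrier (product_gorder I L)"
    then show "x \<sqsubseteq>\<^bsub>product_gorder I L\<^esub> z"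
      using po unfolding product_gorder_def
      by (auto simp: PiE_iff intro: weak_partial_order.le_trans[OF partial_order.axioms(1)])
  next
    fix x y
    assume "x \<sqsubseteq>\<^bsub>product_gorder I L\<^esub> y" "y \<sqsubseteq>\<^bsub>product_gorder I L\<^esub> x"
      and xy: "x \<in> carrier (product_gorder I L)" "y \<in> carrier (product_gorder I L)"
    then have "x i = y i" if "i \<in> I" for i
      using that by (intro partial_order.le_antisym[OF po]) (auto simp: product_gorder_def)
    then show "x .=\<^bsub>product_gorder I L\<^esub> y"
      using xy by (auto simp: product_gorder_def intro: PiE_ext)
  qed (auto simp: product_gorder_def PiE_iff fun_eq_iff
      intro: weak_partial_order.le_refl[OF partial_order.axioms(1)] po)
  show ?thesis
  proof
    fix x y
    assume xy: "x \<in> carrier (product_gorder I L)" "y \<in> carrier (product_gorder I L)"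
    have "\<exists>s. least (L i) s (Upper (L i) {x i, y i})" if "i \<in> I" for i
      using xy that assms[OF that]
      by (auto simp: product_gorder_def intro!: upper_semilattice.sup_of_two_exists
          Lattice.lattice.axioms)
    then obtain s where s: "\<And>i. i \<in> I \<Longrightarrow> least (L i) (s i) (Upper (L i) {x i, y i})" by metis
    \<comment> \<open>Bounds are componentwise; \<open>restrict\<close> supplies the value
      \<open>undefined\<close> off \<open>I\<close> that the carrier demands.\<close>
    have "least (product_gorder I L) (restrict s I) (Upper (product_gorder I L) {x, y})"
      using xy s unfolding least_def Upper_def product_gorder_def by (auto simp: PiE_iff)
    then show "\<exists>s. least (product_gorder I L) s (Upper (product_gorder I L) {x, y})" by blast
    have "\<exists>s. greatest (L i) s (Lower (L i) {x i, y i})" if "i \<in> I" for i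
      using xy that assms[OF that]
      by (auto simp: product_gorder_def intro!: lower_semilattice.inf_of_two_exists
          Lattice.lattice.axioms)
    then obtain s where s: "\<And>i. i \<in> I \<Longrightarrow> greatest (L i) (s i) (Lower (L i) {x i, y i})" by metis
    have "greatest (product_gorder I L) (restrict s I) (Lower (product_gorder I L) {x, y})"
      using xy s unfolding greatest_def Lower_def product_gorder_def by (auto simp: PiE_iff)
    then show "\<exists>s. greatest (product_gorder I L) s (Lower (product_gorder I L) {x, y})" by blast
  qed
qed

section \<open>Partial sums and the order on Gamma\<close>

text \<open>On nondecreasing sequences this inverts the formation of partial sums. The restriction
  to \<open>{..<p}\<close> matches the carrier of \<open>Gamma_order\<close>.\<close>

definition steps :: "nat \<Rightarrow> (nat \<Rightarrow> nat) \<Rightarrow> nat \<Rightarrow> nat" where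
  "steps p C = (\<lambda>k\<in>{..<p}. if k = 0 then C 0 else C k - C (k - 1))"

lemma steps_cong: "(\<And>k. k < p \<Longrightarrow> C k = D k) \<Longrightarrow> steps p C = steps p D"
  by (auto simp: steps_def fun_eq_iff)

text \<open>The sum telescopes; monotonicity of \<open>C\<close> makes the truncated differences
  exact.\<close>

lemma sum_steps:
  assumes "\<And>k. Suc k < p \<Longrightarrow> C k \<le> C (Suc k)" and "k < p"
  shows "(\<Sum>i\<le>k. steps p C i) = C k"
  using assms(2)
proof (induction k)
  case 0
  then show ?case by (simp add: steps_def)
next
  case (Suc k)
  then show ?case using assms(1)[of k] by (simp add: steps_def)
qed

lemma Gamma_partial_sums:
  assumes "r \<in> carrier (Gamma_order \<Delta>)"
  shows "steps (length \<Delta>) (\<lambda>k. \<Sum>i\<le>k. r i) = r"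
proof
  fix k
  show "steps (length \<Delta>) (\<lambda>k. \<Sum>i\<le>k. r i) k = r k"
    using assms by (cases k) (auto simp: steps_def Gamma_order_def PiE_iff extensional_def)
qed

lemma steps_in_Gamma:
  assumes "\<Delta> \<noteq> [] \<Longrightarrow> C 0 \<le> \<Delta> ! 0"
    and "\<And>k. Suc k < length \<Delta> \<Longrightarrow> C (Suc k) \<le> C k + \<Delta> ! Suc k"
  shows "steps (length \<Delta>) C \<in> carrier (Gamma_order \<Delta>)"
proof -
  have "steps (length \<Delta>) C k \<le> \<Delta> ! k" if "k < length \<Delta>" for k
    using that assms by (cases k) (auto simp: steps_def le_diff_conv add.commute)
  then show ?thesis by (auto simp: Gamma_order_def steps_def PiE_iff)
qed

text \<open>Partial sums identify Gamma with the nondecreasing sequences whose increments, starting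
  from 0, are bounded by the entries of \<open>\<Delta>\<close>, ordered pointwise. Pointwise maxima
  and minima of two such sequences are again of this kind.\<close>

lemma lattice_Gamma_order: "Lattice.lattice (Gamma_order \<Delta>)"
proof -
  let ?S = "\<lambda>r k. \<Sum>i\<le>k. r i"
  have le: "r \<sqsubseteq>\<^bsub>Gamma_order \<Delta>\<^esub> s \<longleftrightarrow> (\<forall>k<length \<Delta>. ?S r k \<le> ?S s k)" for r s
    by (simp add: Gamma_order_def)
  have bound: "r k \<le> \<Delta> ! k" if "r \<in> carrier (Gamma_order \<Delta>)" "k < length \<Delta>" for r k
    using that by (auto simp: Gamma_order_def PiE_iff)
  interpret partial_order "Gamma_order \<Delta>"
  proof
    fix x y
    assume "x \<sqsubseteq>\<^bsub>Gamma_order \<Delta>\<^esub> y" "y \<sqsubseteq>\<^bsub>Gamma_order \<Delta>\<^esub> x"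
      and xy: "x \<in> carrier (Gamma_order \<Delta>)" "y \<in> carrier (Gamma_order \<Delta>)"
    then have "?S x k = ?S y k" if "k < length \<Delta>" for k using that by (auto simp: le intro: antisym)
    then have "steps (length \<Delta>) (?S x) = steps (length \<Delta>) (?S y)"
      by (intro steps_cong)
    then show "x .=\<^bsub>Gamma_order \<Delta>\<^esub> y"
      using Gamma_partial_sums[OF xy(1)] Gamma_partial_sums[OF xy(2)] by (simp add: Gamma_order_def)
  next
    fix x y z
    assume "x \<sqsubseteq>\<^bsub>Gamma_order \<Delta>\<^esub> y" "y \<sqsubseteq>\<^bsub>Gamma_order \<Delta>\<^esub> z"
    then show "x \<sqsubseteq>\<^bsub>Gamma_order \<Delta>\<^esub> z" unfolding le using order_trans by blast
  qed (auto simp: Gamma_order_def fun_eq_iff)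
  show ?thesis
  proof
    fix x y assume xy: "x \<in> carrier (Gamma_order \<Delta>)" "y \<in> carrier (Gamma_order \<Delta>)"
    note b = bound[OF xy(1)] bound[OF xy(2)]
    define U where "U = (\<lambda>k. max (?S x k) (?S y k))"
    define D where "D = (\<lambda>k. min (?S x k) (?S y k))"
    have U: "steps (length \<Delta>) U \<in> carrier (Gamma_order \<Delta>)"
      using b by (intro steps_in_Gamma) (fastforce simp: U_def max_def)+
    have D: "steps (length \<Delta>) D \<in> carrier (Gamma_order \<Delta>)"
      using b by (intro steps_in_Gamma) (fastforce simp: D_def min_def)+
    have SU: "?S (steps (length \<Delta>) U) k = U k" if "k < length \<Delta>" for k
      using that by (intro sum_steps) (auto simp: U_def)
    have SD: "?S (steps (length \<Delta>) D) k = D k" if "k < length \<Delta>" for k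
      using that by (intro sum_steps) (auto simp: D_def)
    have "least (Gamma_order \<Delta>) (steps (length \<Delta>) U) (Upper (Gamma_order \<Delta>) {x, y})"
      using xy U SU unfolding least_def Upper_def le by (auto simp: U_def le)
    then show "\<exists>s. least (Gamma_order \<Delta>) s (Upper (Gamma_order \<Delta>) {x, y})" by blast
    have "greatest (Gamma_order \<Delta>) (steps (length \<Delta>) D) (Lower (Gamma_order \<Delta>) {x, y})"
      using xy D SD unfolding greatest_def Lower_def le by (auto simp: D_def le)
    then show "\<exists>s. greatest (Gamma_order \<Delta>) s (Lower (Gamma_order \<Delta>) {x, y})" by blast
  qed
qed

section \<open>Operators commuting with a linear operator\<close>

locale linear_operator = vector_space scale
  for scale :: "'a::field \<Rightarrow> 'b::ab_group_add \<Rightarrow> 'b" +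
  fixes T :: "'b \<Rightarrow> 'b"
  assumes linear_T: "Vector_Spaces.linear scale scale T"
begin

definition shifted :: "'a \<Rightarrow> 'b \<Rightarrow> 'b" where
  "shifted \<mu> = (\<lambda>v. T v - scale \<mu> v)"

definition commuting :: "('b \<Rightarrow> 'b) set" where
  "commuting = {A. Vector_Spaces.linear scale scale A \<and> A \<circ> T = T \<circ> A}"

definition depth :: "'a \<Rightarrow> nat \<Rightarrow> 'b \<Rightarrow> nat" where
  "depth \<mu> m v = (LEAST c. (shifted \<mu> ^^ c) v \<in> range (shifted \<mu> ^^ m))"

lemma linearI:
  assumes "\<And>v w. f (v + w) = f v + f w" "\<And>c v. f (scale c v) = scale c (f v)"
  shows "Vector_Spaces.linear scale scale f"
  by (simp add: Vector_Spaces.linear_iff assms vector_space_axioms)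

lemma linearD:
  assumes "Vector_Spaces.linear scale scale f"
  shows "f (v + w) = f v + f w" "f (scale c v) = scale c (f v)" "f 0 = 0" "f (v - w) = f v - f w"
    "f (sum g I) = (\<Sum>i\<in>I. f (g i))"
proof -
  interpret f: Vector_Spaces.linear scale scale f by (rule assms)
  show "f (v + w) = f v + f w" "f (scale c v) = scale c (f v)" "f 0 = 0" "f (v - w) = f v - f w"
    "f (sum g I) = (\<Sum>i\<in>I. f (g i))"
    by (fact f.add f.scale f.zero f.diff f.sum)+
qed

lemma linear_shifted:  "Vector_Spaces.linear scale scale (shifted \<mu>)"
  by (rule linearI) (auto simp: shifted_def linearD[OF linear_T] algebra_simps)

lemma linear_funpow:
  assumes "Vector_Spaces.linear scale scale f"
  shows "Vector_Spaces.linear scale scale (f ^^ n)"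
  by (induction n) (auto intro!: linearI simp: linearD[OF assms] linearD)

lemma commutingD:
  assumes "A \<in> commuting"
  shows "Vector_Spaces.linear scale scale A" "A (T v) = T (A v)"
    "A ((shifted \<mu> ^^ n) v) = (shifted \<mu> ^^ n) (A v)"
proof -
  show A: "Vector_Spaces.linear scale scale A" and AT: "A (T v) = T (A v)" for v
    using assms by (auto simp: commuting_def fun_eq_iff)
  show "A ((shifted \<mu> ^^ n) v) = (shifted \<mu> ^^ n) (A v)"
    by (induction n) (auto simp: shifted_def linearD[OF A] AT)
qed

lemma commutingI:
  assumes "Vector_Spaces.linear scale scale A" "\<And>v. A (T v) = T (A v)"
  shows "A \<in> commuting"
  using assms by (auto simp: commuting_def)

lemma commuting_add:
  "A \<in> commuting \<Longrightarrow> B \<in> commuting \<Longrightarrow>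
    (\<lambda>v. A v + B v) \<in> commuting"
  by (intro commutingI linearI) (auto simp: commutingD linearD[OF linear_T] linearD[OF commutingD(1)] algebra_simps)

lemma commuting_scale:
  "A \<in> commuting \<Longrightarrow> (\<lambda>v. scale c (A v)) \<in> commuting"
  by (intro commutingI linearI) (auto simp: commutingD linearD[OF linear_T] linearD[OF commutingD(1)] algebra_simps)

lemma commuting_comp:
  "A \<in> commuting \<Longrightarrow> B \<in> commuting \<Longrightarrow> (\<lambda>v. A (B v)) \<in> commuting"
  by (intro commutingI linearI) (auto simp: commutingD linearD[OF commutingD(1)])

lemma commuting_zero: "(\<lambda>v. 0) \<in> commuting"
  by (intro commutingI linearI) (auto simp: linearD[OF linear_T])

lemma commuting_ident: "(\<lambda>v. v) \<in> commuting"
  by (intro commutingI linearI) auto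

lemma commuting_shifted: "shifted \<mu> \<in> commuting"
  using linearD[OF linear_T]
  by (intro commutingI[OF linear_shifted]) (simp add: shifted_def)

lemma commuting_funpow:
  assumes "A \<in> commuting"
  shows "A ^^ n \<in> commuting"
proof (rule commutingI[OF linear_funpow[OF commutingD(1)[OF assms]]])
  show "(A ^^ n) (T v) = T ((A ^^ n) v)" for v
    by (induction n) (auto simp: commutingD(2)[OF assms])
qed

section \<open>Cyclic modules over the algebra of commuting operators\<close>

text \<open>This is the smallest \<open>c(T)\<close>-invariant subspace containing
  \<open>w\<close>.\<close>

definition reach :: "'b \<Rightarrow> 'b set" where
  "reach w = (\<lambda>A. A w) ` commuting"

lemma reachI: "A \<in> commuting \<Longrightarrow> A w \<in> reach w"
  by (simp add: reach_def)

lemma reachE: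
  assumes "u \<in> reach w"
  obtains A where "A \<in> commuting" "u = A w"
  using assms by (auto simp: reach_def)

lemma reach_commuting:
  assumes "u \<in> reach w" "A \<in> commuting"
  shows "A u \<in> reach w"
  using assms(1)
proof (rule reachE)
  fix B assume B: "B \<in> commuting" "u = B w"
  show ?thesis using reachI[OF commuting_comp[OF assms(2) B(1)], of w] by (simp add: B)
qed

lemma reach_refl: "w \<in> reach w"
  using reachI[OF commuting_ident] .

lemma reach_trans: "u \<in> reach v \<Longrightarrow> v \<in> reach w \<Longrightarrow> u \<in> reach w"
  by (metis reachE reach_commuting)

lemma subspace_reach: "subspace (reach w)"
proof (rule subspaceI)
  show "0 \<in> reach w" using reachI[OF commuting_zero] .
next
  fix u v assume uv: "u \<in> reach w" "v \<in> reach w"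
  obtain A where A: "A \<in> commuting" "u = A w" using uv(1) by (rule reachE)
  obtain B where B: "B \<in> commuting" "v = B w" using uv(2) by (rule reachE)
  show "u + v \<in> reach w" using reachI[OF commuting_add[OF A(1) B(1)], of w] by (simp add: A B)
next
  fix u c assume u: "u \<in> reach w"
  obtain A where A: "A \<in> commuting" "u = A w" using u by (rule reachE)
  show "scale c u \<in> reach w" using reachI[OF commuting_scale[OF A(1)], of c w] by (simp add: A)
qed

section \<open>Depth of a vector\<close>

text \<open>Put \<open>N = shifted \<mu>\<close>. The exponent \<open>m\<close> always qualifies and
  the range of \<open>N^m\<close> is invariant under \<open>N\<close>, so the admissible exponents
  form a nonempty up-set, determined by its minimum.\<close>

lemma depth_le_iff:
  "depth \<mu> m v \<le> c \<longleftrightarrow> (shifted \<mu> ^^ c) v \<in> range (shifted \<mu> ^^ m)"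
proof
  let ?N = "shifted \<mu>"
  have ex: "(?N ^^ depth \<mu> m v) v \<in> range (?N ^^ m)"
    unfolding depth_def by (rule LeastI[of _ m]) auto
  assume "depth \<mu> m v \<le> c"
  then obtain d where c: "c = d + depth \<mu> m v" by (metis le_add_diff_inverse2)
  obtain u where "(?N ^^ depth \<mu> m v) v = (?N ^^ m) u" using ex by blast
  then have "(?N ^^ c) v = (?N ^^ m) ((?N ^^ d) u)"
    by (simp add: c funpow_add) (metis funpow_add add.commute comp_apply)
  then show "(?N ^^ c) v \<in> range (?N ^^ m)" by blast
qed (auto simp: depth_def intro: Least_le)

lemma depth_le_self: "depth \<mu> m v \<le> m"
  by (simp add: depth_le_iff)

lemma depth_mono:
  assumes "m \<le> n"
  shows "depth \<mu> m v \<le> depth \<mu> n v"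
proof -
  obtain d where n: "n = m + d" using assms by (auto simp: le_iff_add)
  have "(shifted \<mu> ^^ depth \<mu> n v) v \<in> range (shifted \<mu> ^^ n)" by (simp flip: depth_le_iff)
  then show ?thesis by (auto simp: depth_le_iff n funpow_add)
qed

text \<open>If \<open>N^c v = N^m u\<close>, then \<open>N^(c+d) v = N^(m+d) u\<close>. Together
  with \<open>depth_mono\<close> this keeps the growth of the depth between consecutive block sizes
  within the block increment.\<close>

lemma depth_add_le: "depth \<mu> (m + d) v \<le> depth \<mu> m v + d"
proof -
  obtain u where "(shifted \<mu> ^^ depth \<mu> m v) v = (shifted \<mu> ^^ m) u"
    using depth_le_iff[of \<mu> m v "depth \<mu> m v"] by auto
  then have "(shifted \<mu> ^^ (d + depth \<mu> m v)) v = (shifted \<mu> ^^ (d + m)) u"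
    by (simp add: funpow_add)
  then show ?thesis by (auto simp: depth_le_iff add.commute)
qed

text \<open>A commuting operator carries the witness \<open>u\<close> for \<open>v\<close> to a
  witness for the image of \<open>v\<close>. In particular, depths are constant on orbits.\<close>

lemma depth_reach_le:
  assumes "w \<in> reach v"
  shows "depth \<mu> m w \<le> depth \<mu> m v"
proof -
  obtain A where A: "A \<in> commuting" "w = A v" using assms by (rule reachE)
  obtain u where "(shifted \<mu> ^^ depth \<mu> m v) v = (shifted \<mu> ^^ m) u"
    using depth_le_iff[of \<mu> m v "depth \<mu> m v"] by auto
  then have "(shifted \<mu> ^^ depth \<mu> m v) (A v) = (shifted \<mu> ^^ m) (A u)"
    by (simp flip: commutingD(3)[OF A(1)])
  then show ?thesis by (auto simp: depth_le_iff A)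
qed

end

section \<open>Jordan chains\<close>

text \<open>The vector \<open>b j a\<close> is \<open>(T - ev j)\<^sup>a\<close> applied to the generator of the \<open>j\<close>-th chain, so it is
  \<open>0\<close> past the end of the chain; \<open>x v j a\<close> is the coordinate of \<open>v\<close> at \<open>b j a\<close>.\<close>

locale jordan_chains = linear_operator scale T
  for scale :: "'a::field \<Rightarrow> 'b::ab_group_add \<Rightarrow> 'b" and T :: "'b \<Rightarrow> 'b" +
  fixes q :: nat and len :: "nat \<Rightarrow> nat" and ev :: "nat \<Rightarrow> 'a"
    and b :: "nat \<Rightarrow> nat \<Rightarrow> 'b" and x :: "'b \<Rightarrow> nat \<Rightarrow> nat \<Rightarrow> 'a"
  assumes coord_add: "x (v + w) j a = x v j a + x w j a"
    and coord_scale: "x (scale c v) j a = c * x v j a"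
    and coord_basis: "\<lbrakk>i < q; d < len i; j < q; a < len j\<rbrakk> \<Longrightarrow> x (b i d) j a = (if i = j \<and> d = a then 1 else 0)"
    and expansion: "v = (\<Sum>j<q. \<Sum>a<len j. scale (x v j a) (b j a))"
    and T_basis: "\<lbrakk>j < q; a < len j\<rbrakk> \<Longrightarrow> T (b j a) = scale (ev j) (b j a) + b j (Suc a)"
    and basis_zero: "\<lbrakk>j < q; len j \<le> a\<rbrakk> \<Longrightarrow> b j a = 0"
    and len_pos: "j < q \<Longrightarrow> 0 < len j"
begin

section \<open>Coordinates along the chains\<close>

lemma coord_zero: "x 0 j a = 0"
  using coord_scale[of 0 0] by simp

lemma coord_sum: "x (sum f I) j a = (\<Sum>i\<in>I. x (f i) j a)"
  by (induction I rule: infinite_finite_induct) (auto simp: coord_add coord_zero)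

lemma coord_b: "\<lbrakk>i < q; j < q; a < len j\<rbrakk> \<Longrightarrow> x (b i d) j a = (if i = j \<and> d = a then 1 else 0)"
  by (cases "d < len i") (auto simp: coord_basis basis_zero coord_zero)

lemma T_b: "j < q \<Longrightarrow> T (b j a) = scale (ev j) (b j a) + b j (Suc a)"
  by (cases "a < len j") (auto simp: T_basis basis_zero linearD[OF linear_T])

lemma shifted_b: "j < q \<Longrightarrow> shifted \<mu> (b j a) = scale (ev j - \<mu>) (b j a) + b j (Suc a)"
  by (simp add: shifted_def T_b scale_left_diff_distrib)

lemma shifted_funpow_b: "j < q \<Longrightarrow> (shifted (ev j) ^^ n) (b j a) = b j (a + n)"
  by (induction n) (auto simp: shifted_b)

lemma linear_expansion:
  assumes "Vector_Spaces.linear scale scale f"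
  shows "f v = (\<Sum>j<q. \<Sum>a<len j. scale (x v j a) (f (b j a)))"
  by (subst expansion[of v]) (simp add: linearD[OF assms])

lemma linear_eq_on_chains:
  assumes "Vector_Spaces.linear scale scale f" "Vector_Spaces.linear scale scale g"
    and "\<And>j a. j < q \<Longrightarrow> f (b j a) = g (b j a)"
  shows "f v = g v"
  unfolding linear_expansion[OF assms(1), of v] linear_expansion[OF assms(2), of v]
  using assms(3) by (intro sum.cong) auto

section \<open>Homomorphisms between chains\<close>

definition chain_map :: "(nat \<Rightarrow> nat \<Rightarrow> 'b) \<Rightarrow> 'b \<Rightarrow> 'b" where
  "chain_map g v = (\<Sum>j<q. \<Sum>a<len j. scale (x v j a) (g j a))"

lemma linear_chain_map: "Vector_Spaces.linear scale scale (chain_map g)"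
  by (rule linearI)
    (auto simp: chain_map_def coord_add coord_scale scale_left_distrib sum.distrib scale_sum_right)

lemma chain_map_b:
  assumes j: "j < q" "a < len j"
  shows "chain_map g (b j a) = g j a"
proof -
  have "chain_map g (b j a) = (\<Sum>i<q. \<Sum>d<len i. if j = i \<and> a = d then g i d else 0)"
    unfolding chain_map_def using j by (intro sum.cong refl) (auto simp: coord_b)
  also have "\<dots> = (\<Sum>i<q. if j = i then \<Sum>d<len i. if a = d then g i d else 0 else 0)"
    by (intro sum.cong refl) auto
  also have "\<dots> = g j a" using j by (simp add: sum.delta)
  finally show ?thesis .
qed

definition chain_hom :: "nat \<Rightarrow> nat \<Rightarrow> nat \<Rightarrow> 'b \<Rightarrow> 'b" where
  "chain_hom i j s = chain_map (\<lambda>k a. if k = i then b j (a + s) else 0)"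

text \<open>The bound on \<open>len j\<close> makes \<open>b j (a + s)\<close> vanish as soon as
  \<open>b i a\<close> does, so the formula stays correct past the end of chain
  \<open>i\<close>.\<close>

lemma chain_hom_b:
  assumes "i < q" "j < q" "len j \<le> len i + s" "k < q"
  shows "chain_hom i j s (b k a) = (if k = i then b j (a + s) else 0)"
proof (cases "a < len k")
  case True
  then show ?thesis using assms by (simp add: chain_hom_def chain_map_b)
next
  case False
  then show ?thesis
    using assms by (auto simp: chain_hom_def basis_zero[of k] linearD[OF linear_chain_map] intro!: basis_zero)
qed

text \<open>On both chains \<open>T\<close> is the same scalar plus a shift of the index, and this
  commutes with shifting one chain into the other.\<close>

lemma chain_hom_commuting:
  assumes "i < q" "j < q" "len j \<le> len i + s" "ev i = ev j"
  shows "chain_hom i j s \<in> commuting"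
proof (rule commutingI)
  have lin: "Vector_Spaces.linear scale scale (chain_hom i j s)"
    unfolding chain_hom_def by (rule linear_chain_map)
  then show "Vector_Spaces.linear scale scale (chain_hom i j s)" .
  have eq: "chain_hom i j s (T (b k a)) = T (chain_hom i j s (b k a))" if "k < q" for k a
    using that assms by (auto simp: T_b chain_hom_b linearD[OF lin] linearD[OF linear_T])
  have comp: "Vector_Spaces.linear scale scale (\<lambda>v. chain_hom i j s (T v))"
    "Vector_Spaces.linear scale scale (\<lambda>v. T (chain_hom i j s v))"
    by (auto intro!: linearI simp: linearD[OF lin] linearD[OF linear_T])
  show "chain_hom i j s (T v) = T (chain_hom i j s v)" for v
    using comp eq by (rule linear_eq_on_chains)
qed

text \<open>For isolating a chain: this projection commutes with \<open>T\<close>, so the part of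
  \<open>w\<close> on chain \<open>i\<close> is reachable from \<open>w\<close>.\<close>

lemma chain_projection:
  assumes "i < q"
  shows "chain_hom i i 0 v = (\<Sum>a<len i. scale (x v i a) (b i a))"
proof -
  have "chain_hom i i 0 v = (\<Sum>j<q. if j = i then \<Sum>a<len j. scale (x v j a) (b j a) else 0)"
    unfolding chain_hom_def chain_map_def by (intro sum.cong refl) auto
  then show ?thesis using assms by simp
qed

section \<open>Depth in coordinates\<close>

lemma coord_shifted:
  assumes j: "j < q" "a < len j"
  shows "x (shifted (ev j) v) j a = (if a = 0 then 0 else x v j (a - 1))"
proof -
  have "x (shifted (ev j) v) j a
      = (\<Sum>i<q. \<Sum>d<len i. x v i d * x (shifted (ev j) (b i d)) j a)"
    using linear_expansion[OF linear_shifted, of "ev j" v] by (simp only: coord_sum coord_scale)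
  also have "\<dots> = (\<Sum>i<q. if i = j then \<Sum>d<len i. if Suc d = a then x v i d else 0 else 0)"
    using j by (intro sum.cong refl) (auto simp: shifted_b coord_add coord_scale coord_b intro!: sum.cong)
  also have "\<dots> = (\<Sum>d<len j. if Suc d = a then x v j d else 0)" using j by simp
  also have "\<dots> = (if a = 0 then 0 else x v j (a - 1))"
  proof (cases a)
    case (Suc a')
    then have "(\<Sum>d<len j. if Suc d = a then x v j d else 0) = (\<Sum>d<len j. if d = a' then x v j d else 0)"
      by (intro sum.cong) auto
    then show ?thesis using Suc j by simp
  qed simp
  finally show ?thesis .
qed

lemma coord_shifted_funpow:
  assumes "j < q" "a < len j"
  shows "x ((shifted (ev j) ^^ n) v) j a = (if n \<le> a then x v j (a - n) else 0)"
  using assms(2)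
proof (induction n arbitrary: a)
  case (Suc n)
  then show ?case using assms(1) by (auto simp: coord_shifted)
qed simp

lemma subspace_range_shifted: "subspace (range (shifted \<mu> ^^ m))"
proof -
  interpret f: Vector_Spaces.linear scale scale "shifted \<mu> ^^ m"
    by (rule linear_funpow[OF linear_shifted])
  show ?thesis by (rule f.subspace_image[OF subspace_UNIV])
qed

lemmas range_shifted =
  subspace_0[OF subspace_range_shifted] subspace_add[OF subspace_range_shifted]
  subspace_scale[OF subspace_range_shifted] subspace_sum[OF subspace_range_shifted]

lemma funpow_in_range_shifted:
  assumes "u \<in> range (shifted \<mu> ^^ m)"
  shows "(shifted \<mu> ^^ n) u \<in> range (shifted \<mu> ^^ m)"
proof -
  obtain w where "u = (shifted \<mu> ^^ m) w" using assms by blast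
  then have "(shifted \<mu> ^^ n) u = (shifted \<mu> ^^ m) ((shifted \<mu> ^^ n) w)"
    by (metis add.commute comp_apply funpow_add)
  then show ?thesis by blast
qed

text \<open>The outer induction raises the power. The inner one runs backwards from the end of the
  chain and solves the formula for \<open>shifted \<mu> (b j a)\<close> for \<open>b j a\<close>,
  which is possible because \<open>ev j - \<mu>\<close> is nonzero.\<close>

lemma b_in_range_shifted:
  assumes j: "j < q" and ne: "ev j \<noteq> \<mu>"
  shows "b j a \<in> range (shifted \<mu> ^^ m)"
proof (induction m arbitrary: a)
  case (Suc m)
  have "b j a \<in> range (shifted \<mu> ^^ Suc m)" if "len j \<le> a + d" for a d
    using that
  proof (induction d arbitrary: a)
    case 0
    then show ?case using basis_zero[OF j] range_shifted(1) by (metis add_0_right)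
  next
    case (Suc d)
    have eq: "b j a = scale (inverse (ev j - \<mu>)) (shifted \<mu> (b j a) + scale (- 1) (b j (Suc a)))"
      using ne by (simp add: shifted_b[OF j])
    obtain u where "b j a = (shifted \<mu> ^^ m) u" using \<open>\<And>a. b j a \<in> range (shifted \<mu> ^^ m)\<close> by blast
    then have "shifted \<mu> (b j a) \<in> range (shifted \<mu> ^^ Suc m)" by auto
    moreover have "b j (Suc a) \<in> range (shifted \<mu> ^^ Suc m)" using Suc by auto
    ultimately show ?case by (subst eq) (intro range_shifted)
  qed
  then show ?case by (metis le_add2)
qed simp

text \<open>Only the chains with eigenvalue \<open>\<mu>\<close> matter, as \<open>T - \<mu>\<close> is invertible on the others; on a chain
  with eigenvalue \<open>\<mu>\<close> it shifts the coordinates.\<close>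

lemma depth_le_iff_coords:
  "depth \<mu> m v \<le> c \<longleftrightarrow> (\<forall>j<q. ev j = \<mu> \<longrightarrow> (\<forall>a. a + c < min m (len j) \<longrightarrow> x v j a = 0))"
proof
  assume "depth \<mu> m v \<le> c"
  then obtain u where u: "(shifted \<mu> ^^ c) v = (shifted \<mu> ^^ m) u"
    by (auto simp: depth_le_iff)
  show "\<forall>j<q. ev j = \<mu> \<longrightarrow> (\<forall>a. a + c < min m (len j) \<longrightarrow> x v j a = 0)"
  proof (intro allI impI)
    fix j a assume j: "j < q" "ev j = \<mu>" and a: "a + c < min m (len j)"
    have "x v j a = x ((shifted \<mu> ^^ c) v) j (a + c)"
      using coord_shifted_funpow[OF j(1), of "a + c" c v] a j by simp
    also have "\<dots> = 0"
      using coord_shifted_funpow[OF j(1), of "a + c" m u] a j by (simp add: u)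
    finally show "x v j a = 0" .
  qed
next
  assume *: "\<forall>j<q. ev j = \<mu> \<longrightarrow> (\<forall>a. a + c < min m (len j) \<longrightarrow> x v j a = 0)"
  let ?R = "range (shifted \<mu> ^^ m)"
  have "scale (x v j a) ((shifted \<mu> ^^ c) (b j a)) \<in> ?R" if j: "j < q" "a < len j" for j a
  proof (cases "ev j = \<mu>")
    case True
    \<comment> \<open>The coordinate vanishes, or the image is past the end of the chain, or the
      image is \<open>N^m\<close> of a chain vector, where \<open>N = shifted \<mu>\<close>.\<close>
    consider "a + c < min m (len j)" | "len j \<le> a + c" | "m \<le> a + c" by linarith
    then show ?thesis
    proof cases
      case 1
      then show ?thesis using * j True range_shifted(1) by simp
    next
      case 2
      then show ?thesis using shifted_funpow_b[OF j(1), of c a] True j range_shifted(1)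
        by (simp add: basis_zero)
    next
      case 3
      then have "(shifted \<mu> ^^ c) (b j a) = (shifted \<mu> ^^ m) (b j (a + c - m))"
        using shifted_funpow_b[OF j(1)] True by force
      then have "(shifted \<mu> ^^ c) (b j a) \<in> ?R" by simp
      then show ?thesis by (rule range_shifted(3))
    qed
  next
    case False
    then show ?thesis using j by (intro range_shifted funpow_in_range_shifted b_in_range_shifted)
  qed
  then have "(shifted \<mu> ^^ c) v \<in> ?R"
    by (subst linear_expansion[OF linear_funpow[OF linear_shifted]]) (auto intro!: range_shifted(4))
  then show "depth \<mu> m v \<le> c" by (simp add: depth_le_iff)
qed

section \<open>Depth decides reachability\<close>

text \<open>Project \<open>w\<close> to chain \<open>i\<close> and shift by \<open>e - a\<close>.
  The leading term becomes a nonzero multiple of \<open>b i e\<close>; the later terms lie further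
  down the chain and are reachable by induction on the distance to its end.\<close>

lemma leading_basis_reachable:
  assumes i: "i < q" "x w i a \<noteq> 0" "a < len i" and least: "\<And>d. d < a \<Longrightarrow> x w i d = 0"
    and "a \<le> e"
  shows "b i e \<in> reach w"
proof -
  have "b i e \<in> reach w" if "len i \<le> e + d" "a \<le> e" for d e
    using that
  proof (induction d arbitrary: e)
    case 0
    then show ?case using basis_zero[OF i(1)] subspace_0[OF subspace_reach] by simp
  next
    case (Suc d)
    let ?n = "e - a" and ?K = "{..<len i} - {a}"
    let ?P = "(shifted (ev i) ^^ ?n) (chain_hom i i 0 w)"
    have tail: "scale (x w i k) (b i (k + ?n)) \<in> reach w" if "k \<noteq> a" for k
    proof (cases "k < a")
      case True
      then show ?thesis using least subspace_0[OF subspace_reach] by simp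
    next
      case False
      then have "len i \<le> k + ?n + d" "a \<le> k + ?n" using Suc.prems that by linarith+
      then show ?thesis using Suc.IH subspace_scale[OF subspace_reach] by blast
    qed
    have P: "?P \<in> reach w"
      by (rule reach_commuting[OF reach_commuting[OF reach_refl]])
        (use i in \<open>auto intro!: commuting_funpow commuting_shifted chain_hom_commuting\<close>)
    have "?P = (\<Sum>k<len i. scale (x w i k) (b i (k + ?n)))"
      unfolding chain_projection[OF i(1)]
      by (simp add: linearD[OF linear_funpow[OF linear_shifted]] shifted_funpow_b i)
    also have "\<dots> = scale (x w i a) (b i e) + (\<Sum>k\<in>?K. scale (x w i k) (b i (k + ?n)))"
      using i Suc.prems by (simp add: sum.remove[of "{..<len i}" a])
    finally have "b i e = scale (inverse (x w i a)) (?P - (\<Sum>k\<in>?K. scale (x w i k) (b i (k + ?n))))"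
      using i by simp
    also have "\<dots> \<in> reach w"
      by (intro subspace_scale[OF subspace_reach] subspace_diff[OF subspace_reach]
          subspace_sum[OF subspace_reach] P tail) auto
    finally show ?case .
  qed
  then show ?thesis using assms(5) le_add2 by blast
qed

text \<open>It suffices to reach each basis vector occurring in \<open>v\<close>, which is done by a
  homomorphism from a chain on which \<open>w\<close> has a suitable leading term.\<close>

lemma reachable_if_depth_le:
  assumes le: "\<And>j. j < q \<Longrightarrow> depth (ev j) (len j) v \<le> depth (ev j) (len j) w"
  shows "v \<in> reach w"
proof -
  have "scale (x v j a) (b j a) \<in> reach w" if j: "j < q" "a < len j" for j a
  proof (cases "x v j a = 0")
    case True
    then show ?thesis using subspace_0[OF subspace_reach] by simp
  next
    case False
    \<comment> \<open>It takes \<open>c + 1\<close> steps to push \<open>b j a\<close> off its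
      chain, so its occurrence in \<open>v\<close> forces a depth greater than
      \<open>c\<close>.\<close>
    define c where "c = len j - a - 1"
    have "\<not> depth (ev j) (len j) v \<le> c"
    proof
      assume "depth (ev j) (len j) v \<le> c"
      moreover have "a + c < min (len j) (len j)" using j by (simp add: c_def)
      ultimately show False using False j depth_le_iff_coords by blast
    qed
    then have "\<not> depth (ev j) (len j) w \<le> c" using le[OF j(1)] by linarith
    \<comment> \<open>The inequality for \<open>d\<close> means \<open>d \<le> a\<close> and
      \<open>len j \<le> len i + (a - d)\<close>, exactly what a chain homomorphism taking
      \<open>b i d\<close> to \<open>b j a\<close> requires.\<close>
    then obtain i d where i: "i < q" "ev i = ev j" and d: "d + c < min (len j) (len i)" "x w i d \<noteq> 0"
      unfolding depth_le_iff_coords by blast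
    \<comment> \<open>The leading coordinate is what \<open>leading_basis_reachable\<close> can
      handle; replacing \<open>d\<close> by \<open>e \<le> d\<close> preserves both
      inequalities.\<close>
    define e where "e = (LEAST d. x w i d \<noteq> 0)"
    have e: "x w i e \<noteq> 0" "e \<le> d" "\<And>d'. d' < e \<Longrightarrow> x w i d' = 0"
      unfolding e_def using LeastI[of "\<lambda>d. x w i d \<noteq> 0", OF d(2)]
        Least_le[of "\<lambda>d. x w i d \<noteq> 0", OF d(2)] not_less_Least[of _ "\<lambda>d. x w i d \<noteq> 0"]
      by blast+
    have "e < len i" using d e(2) by linarith
    then have bi: "b i e \<in> reach w" using leading_basis_reachable[OF i(1) e(1) _ e(3)] by simp
    have "e \<le> a" and len: "len j \<le> len i + (a - e)" using d e(2) j by (auto simp: c_def)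
    then have "chain_hom i j (a - e) (b i e) = b j a"
      using chain_hom_b[OF i(1) j(1) len i(1)] by simp
    then have "b j a \<in> reach w"
      using reach_commuting[OF bi chain_hom_commuting[OF i(1) j(1) len i(2)]] by simp
    then show ?thesis by (rule subspace_scale[OF subspace_reach])
  qed
  then show ?thesis
    by (subst expansion[of v]) (intro subspace_sum[OF subspace_reach], auto)
qed

text \<open>A depth of \<open>v\<close> exceeding that of \<open>w\<close> shows in a nonzero
  coordinate of \<open>v\<close> which vanishes on all vectors of depth at most that of
  \<open>w\<close>. This functional later keeps \<open>v\<close> out of the closure of the orbit of
  \<open>w\<close>.\<close>

lemma separating_coord:
  assumes "v \<notin> reach w"
  shows "\<exists>i a. x v i a \<noteq> 0 \<and> (\<forall>u\<in>reach w. x u i a = 0)"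
proof -
  obtain j where j: "j < q" "\<not> depth (ev j) (len j) v \<le> depth (ev j) (len j) w"
    using assms reachable_if_depth_le by blast
  then obtain i a where i: "i < q" "ev i = ev j"
    "a + depth (ev j) (len j) w < min (len j) (len i)" "x v i a \<noteq> 0"
    by (subst (asm) depth_le_iff_coords) auto
  have "x u i a = 0" if "u \<in> reach w" for u
    using depth_reach_le[OF that, of "ev j" "len j"] i depth_le_iff_coords by blast
  then show ?thesis using i by blast
qed

section \<open>Realization of depths and uniqueness of block sizes\<close>

text \<open>Take from each chain the vector that dies after exactly the prescribed number of steps.
  It has the right depth on its own chain, and the growth conditions on \<open>C\<close> prevent the
  other chains from increasing it.\<close>

lemma realizable_depth:
  assumes self: "\<And>j. j < q \<Longrightarrow> C (ev j) (len j) \<le> len j"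
    and step: "\<And>i j. \<lbrakk>i < q; j < q; ev i = ev j; len i \<le> len j\<rbrakk> \<Longrightarrow>
      C (ev i) (len i) \<le> C (ev j) (len j) \<and> C (ev j) (len j) \<le> C (ev i) (len i) + (len j - len i)"
  shows "\<exists>v. \<forall>j<q. depth (ev j) (len j) v = C (ev j) (len j)"
proof -
  \<comment> \<open>For \<open>C (ev j) (len j) = 0\<close> the summand is
    \<open>b j (len j) = 0\<close>.\<close>
  define v where "v = (\<Sum>j<q. b j (len j - C (ev j) (len j)))"
  have xv: "x v i a = (if a = len i - C (ev i) (len i) then 1 else 0)" if i: "i < q" "a < len i" for i a
  proof -
    have "x v i a = (\<Sum>j<q. if j = i then (if a = len i - C (ev i) (len i) then 1 else 0) else 0)"
      unfolding v_def coord_sum using i by (intro sum.cong) (auto simp: coord_b)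
    then show ?thesis using i by simp
  qed
  have "depth (ev j) (len j) v = C (ev j) (len j)" if j: "j < q" for j
  proof (rule antisym)
    show "depth (ev j) (len j) v \<le> C (ev j) (len j)"
      unfolding depth_le_iff_coords
    proof (intro allI impI)
      fix i a assume i: "i < q" "ev i = ev j" and a: "a + C (ev j) (len j) < min (len j) (len i)"
      \<comment> \<open>If chain \<open>i\<close> is not longer than chain \<open>j\<close>,
        monotonicity of \<open>C\<close> applies; otherwise the bound on its growth does.\<close>
      have "a \<noteq> len i - C (ev i) (len i)"
        using step[OF i(1) j] step[OF j i(1)] i a self[OF i(1)] self[OF j]
        by (cases "len i \<le> len j") auto
      then show "x v i a = 0" using xv[OF i(1), of a] a by simp
    qed
    show "C (ev j) (len j) \<le> depth (ev j) (len j) v"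
    proof (rule ccontr)
      let ?a = "len j - C (ev j) (len j)"
      assume "\<not> ?thesis"
      then have a: "?a + depth (ev j) (len j) v < min (len j) (len j)" using self[OF j] by linarith
      then have "x v j ?a = 0" using depth_le_iff_coords[of "ev j" "len j" v] j by blast
      then show False using xv[OF j, of ?a] a by simp
    qed
  qed
  then show ?thesis by blast
qed

text \<open>The right-hand side does not mention the chains; this gives the uniqueness of the block sizes.
  The last vector of a chain of length \<open>m\<close> is a witness.\<close>

lemma chain_of_length_iff:
  "(\<exists>j<q. len j = m \<and> ev j = \<mu>) \<longleftrightarrow>
    m \<noteq> 0 \<and> (\<exists>v. depth \<mu> (m - 1) v \<le> 0 \<and> \<not> depth \<mu> m v \<le> 0 \<and> depth \<mu> (Suc m) v \<le> 1)"
proof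
  assume "\<exists>j<q. len j = m \<and> ev j = \<mu>"
  then obtain j where j: "j < q" and eqs: "m = len j" "\<mu> = ev j" by blast
  let ?v = "b j (len j - 1)"
  have "x ?v j (len j - 1) = 1" using coord_b j len_pos[OF j] by simp
  then have "\<not> depth (ev j) (len j) ?v \<le> 0"
    using j len_pos[OF j] by (subst depth_le_iff_coords) force
  moreover have "depth (ev j) (len j - 1) ?v \<le> 0" "depth (ev j) (Suc (len j)) ?v \<le> 1"
    unfolding depth_le_iff_coords by (auto simp: coord_b j)
  ultimately show "m \<noteq> 0 \<and> (\<exists>v. depth \<mu> (m - 1) v \<le> 0 \<and> \<not> depth \<mu> m v \<le> 0 \<and> depth \<mu> (Suc m) v \<le> 1)"
    using len_pos[OF j] eqs by blast
next
  assume "m \<noteq> 0 \<and> (\<exists>v. depth \<mu> (m - 1) v \<le> 0 \<and> \<not> depth \<mu> m v \<le> 0 \<and> depth \<mu> (Suc m) v \<le> 1)"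
  then obtain v where m: "m \<noteq> 0"
    and v: "depth \<mu> (m - 1) v \<le> 0" "\<not> depth \<mu> m v \<le> 0" "depth \<mu> (Suc m) v \<le> 1" by blast
  obtain j a where j: "j < q" "ev j = \<mu>" "a < min m (len j)" "x v j a \<noteq> 0"
    using v(2) unfolding depth_le_iff_coords by auto
  \<comment> \<open>The first two conditions give \<open>a = m - 1\<close>, the third then gives
    \<open>len j \<le> m\<close>.\<close>
  have "\<not> a < min (m - 1) (len j)" using v(1) j unfolding depth_le_iff_coords by auto
  moreover have "\<not> a + 1 < min (Suc m) (len j)" using v(3) j unfolding depth_le_iff_coords by auto
  ultimately have "len j = m" using j m by linarith
  then show "\<exists>j<q. len j = m \<and> ev j = \<mu>" using j by blast
qed

lemma ev_in_spectrum:
  assumes "j < q"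
  shows "\<exists>v. v \<noteq> 0 \<and> T v = scale (ev j) v"
proof (intro exI conjI)
  show "b j (len j - 1) \<noteq> 0"
    using coord_b[OF assms assms, of "len j - 1" "len j - 1"] len_pos[OF assms] coord_zero by force
  show "T (b j (len j - 1)) = scale (ev j) (b j (len j - 1))"
    using T_b[OF assms, of "len j - 1"] len_pos[OF assms] basis_zero[OF assms] by simp
qed

end

section \<open>Orbits of the centralizer group and their closures\<close>

locale complex_operator = linear_operator scale T + finite_dimensional_vector_space scale Basis
  for scale :: "complex \<Rightarrow> 'v::ab_group_add \<Rightarrow> 'v" and T :: "'v \<Rightarrow> 'v" and Basis :: "'v set"
begin

section \<open>Invertible operators are generic\<close>

text \<open>Applying \<open>A - s\<close> for the new eigenvalue \<open>s\<close> kills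
  \<open>e s\<close> and multiplies every other \<open>e t\<close> by the nonzero factor
  \<open>t - s\<close>, which leaves a shorter relation.\<close>

lemma eigenvectors_zero_sum:
  assumes A: "Vector_Spaces.linear scale scale A" and "finite F"
    and "\<And>t. t \<in> F \<Longrightarrow> A (e t) = scale t (e t)" "(\<Sum>t\<in>F. e t) = 0" "t \<in> F"
  shows "e t = 0"
  using assms(2-)
proof (induction F arbitrary: e t rule: finite_induct)
  case (insert s F)
  have sum0: "e s + (\<Sum>t\<in>F. e t) = 0" using insert by simp
  have "A (e s + (\<Sum>t\<in>F. e t)) - scale s (e s + (\<Sum>t\<in>F. e t)) = 0"
    by (simp add: sum0 linearD[OF A])
  also have "A (e s + (\<Sum>t\<in>F. e t)) - scale s (e s + (\<Sum>t\<in>F. e t))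
      = (\<Sum>t\<in>F. scale t (e t)) - (\<Sum>t\<in>F. scale s (e t))"
    using insert.prems by (simp add: linearD[OF A] scale_right_distrib scale_sum_right)
  also have "\<dots> = (\<Sum>t\<in>F. scale (t - s) (e t))"
    by (simp add: sum_subtractf[symmetric] scale_left_diff_distrib)
  finally have sumF: "(\<Sum>t\<in>F. scale (t - s) (e t)) = 0" .
  have "scale (t - s) (e t) = 0" if "t \<in> F" for t
  proof (rule insert.IH[OF _ sumF that])
    fix t assume "t \<in> F"
    then show "A (scale (t - s) (e t)) = scale t (scale (t - s) (e t))"
      using insert.prems by (simp add: linearD[OF A] mult.commute)
  qed
  then have F0: "e t = 0" if "t \<in> F" for t using that insert.hyps by auto
  then have "e s = 0" using sum0 by simp
  then show ?case using F0 insert.prems by blast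
qed simp

text \<open>Eigenvectors for distinct eigenvalues are independent, so the dimension bounds the size
  of every finite set of eigenvalues.\<close>

lemma finite_eigenvalues:
  assumes A: "Vector_Spaces.linear scale scale A"
  shows "finite {t. \<exists>v. v \<noteq> 0 \<and> A v = scale t v}" (is "finite ?E")
proof (rule conjunct1[OF finite_if_finite_subsets_card_bdd[of _ "dim UNIV"]])
  show "card F \<le> dim UNIV" if F: "F \<subseteq> ?E" "finite F" for F
  proof -
    from F have "\<forall>t\<in>F. \<exists>v. v \<noteq> 0 \<and> A v = scale t v" by auto
    then obtain e where e: "\<And>t. t \<in> F \<Longrightarrow> e t \<noteq> 0" "\<And>t. t \<in> F \<Longrightarrow> A (e t) = scale t (e t)"
      by metis
    have inj: "inj_on e F"
      by (rule inj_onI) (metis e scale_right_imp_eq)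
    have "independent (e ` F)"
    proof
      assume "dependent (e ` F)"
      then obtain u t where t: "t \<in> F" "u (e t) \<noteq> 0" and "(\<Sum>v\<in>e ` F. scale (u v) v) = 0"
        using F(2) by (auto simp: dependent_finite)
      then have "(\<Sum>t\<in>F. scale (u (e t)) (e t)) = 0" by (simp add: sum.reindex[OF inj])
      then have "scale (u (e t)) (e t) = 0"
        using eigenvectors_zero_sum[OF A F(2), of "\<lambda>t. scale (u (e t)) (e t)" t] e(2) t(1)
        by (simp add: linearD[OF A] mult.commute)
      then show False using t e(1) by simp
    qed
    then show "card F \<le> dim UNIV"
      using independent_card_le_dim[of "e ` F" UNIV] by (simp add: card_image[OF inj])
  qed
qed

lemma commuting_inverse:
  assumes A: "A \<in> commuting" and ker: "\<And>u. A u = 0 \<Longrightarrow> u = 0"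
  shows "bij A" "inv_into UNIV A \<in> commuting"
proof -
  have lin: "Vector_Spaces.linear scale scale A" by (rule commutingD(1)[OF A])
  have "inj A"
  proof (rule injI)
    fix u v assume "A u = A v"
    then have "A (u - v) = 0" by (simp add: linearD[OF lin])
    then show "u = v" using ker by force
  qed
  then show bij: "bij A" using linear_inj_imp_surj[OF lin] by (simp add: bij_def)
  note [simp] = bij_is_inj[OF bij] surj_f_inv_f[OF bij_is_surj[OF bij]]
  have inv_eqI: "inv_into UNIV A u = v" if "u = A v" for u v using that by simp
  show "inv_into UNIV A \<in> commuting"
    by (intro commutingI linearI; rule inv_eqI) (simp_all add: linearD[OF lin] commutingD(2)[OF A])
qed

text \<open>\<open>A + t\<close> is singular exactly when \<open>- t\<close> is an eigenvalue of
  \<open>A\<close>.\<close>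

lemma finite_singular_shifts:
  assumes "A \<in> commuting"
  shows "finite {t. \<exists>u. u \<noteq> 0 \<and> A u + scale t u = 0}"
proof -
  have "A u + scale t u = 0 \<longleftrightarrow> A u = scale (- t) u" for t u
    by (simp add: eq_neg_iff_add_eq_0)
  then have "{t. \<exists>u. u \<noteq> 0 \<and> A u + scale t u = 0} = uminus -` {t. \<exists>u. u \<noteq> 0 \<and> A u = scale t u}"
    by simp
  then show ?thesis
    using finite_vimageI[OF finite_eigenvalues[OF commutingD(1)[OF assms]], of uminus] by simp
qed

section \<open>Orbits and cyclic modules\<close>

abbreviation group_orbit :: "'v \<Rightarrow> 'v set" where
  "group_orbit v \<equiv> orbit (centralizer_group scale T) (\<lambda>U. U) v"

lemma in_group_orbit_iff: "w \<in> group_orbit v \<longleftrightarrow> (\<exists>U\<in>commuting. bij U \<and> U v = w)"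
  by (auto simp: orbit_def centralizer_group_def commuting_def)

lemma group_orbit_refl: "v \<in> group_orbit v"
  unfolding in_group_orbit_iff by (rule bexI[OF _ commuting_ident]) (simp add: bij_betw_def)

lemma group_orbit_subset_reach: "group_orbit v \<subseteq> reach v"
  by (auto simp: in_group_orbit_iff intro: reachI)

text \<open>If \<open>w = A v\<close> and \<open>v = B w\<close>, then \<open>(1 + t A) v = v + t w = (B + t) w\<close>,
  and both operators are invertible for all but finitely many \<open>t\<close>.\<close>

lemma mutual_reach_in_group_orbit:
  assumes "w \<in> reach v" "v \<in> reach w"
  shows "w \<in> group_orbit v"
proof -
  obtain A where A: "A \<in> commuting" "w = A v" using assms(1) by (rule reachE)
  obtain B where B: "B \<in> commuting" "v = B w" using assms(2) by (rule reachE)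
  \<comment> \<open>\<open>S A\<close> collects the \<open>t\<close> for which \<open>A + t\<close>
    is singular. As \<open>1 + t A = t (A + inverse t)\<close> for nonzero \<open>t\<close>,
    avoiding 0, \<open>S B\<close> and the inverses of \<open>S A\<close> makes both operators
    invertible.\<close>
  define S where "S A = {t. \<exists>u. u \<noteq> 0 \<and> A u + scale t u = 0}" for A
  have "finite (S B \<union> inverse ` S A \<union> {0})"
    unfolding S_def using finite_singular_shifts A B by simp
  from ex_new_if_finite[OF infinite_UNIV_char_0 this]
  obtain t where "t \<notin> S B \<union> inverse ` S A \<union> {0}" ..
  then have t: "t \<notin> S B" "t \<notin> inverse ` S A" "t \<noteq> 0" by simp_all
  define X where "X u = u + scale t (A u)" for u
  define Y where "Y u = B u + scale t u" for u
  have X: "X \<in> commuting" unfolding X_def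
    by (intro commuting_add commuting_scale commuting_ident A)
  have Y: "Y \<in> commuting" unfolding Y_def
    by (intro commuting_add commuting_scale commuting_ident B)
  have X0: "u = 0" if "X u = 0" for u
  proof (rule ccontr)
    assume "u \<noteq> 0"
    have "scale (inverse t) (X u) = 0" using that by simp
    then have "A u + scale (inverse t) u = 0"
      using t by (simp add: X_def scale_right_distrib add.commute)
    then have "inverse t \<in> S A" using \<open>u \<noteq> 0\<close> by (auto simp: S_def)
    then show False using t(2) by (metis image_eqI inverse_inverse_eq)
  qed
  have Y0: "u = 0" if "Y u = 0" for u using that t(1) by (auto simp: Y_def S_def)
  note bX = commuting_inverse[OF X X0] and bY = commuting_inverse[OF Y Y0]
  \<comment> \<open>Both sides are \<open>v + t w\<close>, so \<open>X\<close> followed by the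
    inverse of \<open>Y\<close> carries \<open>v\<close> to \<open>w\<close>.\<close>
  have "X v = Y w" using A(2) B(2) by (simp add: X_def Y_def)
  then have "inv_into UNIV Y (X v) = w" using bij_is_inj[OF bY(1)] by simp
  moreover have "(\<lambda>u. inv_into UNIV Y (X u)) \<in> commuting" using commuting_comp bY(2) X by blast
  moreover have "bij (\<lambda>u. inv_into UNIV Y (X u))"
    using bij_comp[OF bX(1) bij_imp_bij_inv[OF bY(1)]] by (simp add: comp_def)
  ultimately show ?thesis unfolding in_group_orbit_iff by blast
qed

text \<open>Reduces questions about orbits to \<open>reach\<close>, by composing with the group
  element from \<open>mutual_reach_in_group_orbit\<close>.\<close>

lemma group_orbit_eq_iff: "group_orbit v = group_orbit w \<longleftrightarrow> v \<in> reach w \<and> w \<in> reach v"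
proof
  assume "group_orbit v = group_orbit w"
  then show "v \<in> reach w \<and> w \<in> reach v"
    using group_orbit_refl group_orbit_subset_reach by blast
next
  assume vw: "v \<in> reach w \<and> w \<in> reach v"
  have "group_orbit v \<subseteq> group_orbit w" if vw: "v \<in> reach w" "w \<in> reach v" for v w
  proof
    fix u assume u: "u \<in> group_orbit v"
    obtain U where U: "U \<in> commuting" "bij U" "U v = u" using u by (auto simp: in_group_orbit_iff)
    obtain W where W: "W \<in> commuting" "bij W" "W w = v"
      using mutual_reach_in_group_orbit[OF vw] by (auto simp: in_group_orbit_iff)
    have "(\<lambda>u. U (W u)) \<in> commuting" "bij (\<lambda>u. U (W u))"
      using commuting_comp[OF U(1) W(1)] bij_comp[OF W(2) U(2)] by (auto simp: comp_def)
    then show "u \<in> group_orbit w" unfolding in_group_orbit_iff using U W by blast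
  qed
  then show "group_orbit v = group_orbit w" using vw by blast
qed

section \<open>The topology and orbit closures\<close>

lemma linear_functionalI:
  assumes "\<And>v w. f (v + w) = f v + f w" "\<And>c v. f (scale c v) = c * f v"
  shows "Vector_Spaces.linear scale (*) f"
proof -
  have "vector_space ((*) :: complex \<Rightarrow> complex \<Rightarrow> complex)"
    by unfold_locales (auto simp: algebra_simps)
  then show ?thesis using assms vector_space_axioms by (simp add: Vector_Spaces.linear_iff)
qed

lemma openin_vector_topology:
  "Vector_Spaces.linear scale (*) f \<Longrightarrow> open W \<Longrightarrow> openin (vector_topology scale) (f -` W)"
  unfolding vector_topology_def by (rule topology_generated_by_Basis) blast

lemma topspace_vector_topology: "topspace (vector_topology scale) = UNIV"
proof -
  have "openin (vector_topology scale) ((\<lambda>v. 0 :: complex) -` UNIV)"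
    by (rule openin_vector_topology) (auto intro: linear_functionalI)
  then show ?thesis using openin_subset by fastforce
qed

text \<open>It suffices to test generating sets, and along a line every linear functional is an
  affine function of \<open>t\<close>.\<close>

lemma continuous_map_line:
  "continuous_map euclidean (vector_topology scale) (\<lambda>t. u + scale t w)"
  unfolding vector_topology_def
proof (rule continuous_on_generated_topo)
  fix S assume "S \<in> {f -` W |f W. Vector_Spaces.linear scale (*) f \<and> open W}"
  then obtain f W where S: "S = f -` W" and f: "Vector_Spaces.linear scale (*) f" and W: "open W"
    by auto
  interpret f: Vector_Spaces.linear scale "(*)" f by (rule f)
  have "(\<lambda>t. u + scale t w) -` S = (\<lambda>t. f u + t * f w) -` W"
    by (auto simp: S f.add f.scale)
  moreover have "open ((\<lambda>t. f u + t * f w) -` W)"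
    using W by (intro open_vimage continuous_intros)
  ultimately show "openin euclidean ((\<lambda>t. u + scale t w) -` S \<inter> topspace euclidean)" by simp
next
  show "(\<lambda>t. u + scale t w) ` topspace euclidean
      \<subseteq> \<Union> {f -` W |f W. Vector_Spaces.linear scale (*) f \<and> open W}"
    using topspace_vector_topology unfolding vector_topology_def topology_generated_by_topspace
    by auto
qed

text \<open>The point \<open>A w\<close> is the limit of \<open>(A + t) w\<close> as \<open>t \<rightarrow> 0\<close>, and \<open>A + t\<close> is invertible for
  all small \<open>t \<noteq> 0\<close>.\<close>

lemma reach_subset_closure: "reach w \<subseteq> vector_topology scale closure_of group_orbit w"
proof
  fix u assume "u \<in> reach w"
  then obtain A where A: "A \<in> commuting" "u = A w" by (rule reachE)
  define S where "S = {t. \<exists>u. u \<noteq> 0 \<and> A u + scale t u = 0}"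
  have "\<exists>y\<in>group_orbit w. y \<in> W" if W: "u \<in> W" "openin (vector_topology scale) W" for W
  proof -
    let ?L = "{t. u + scale t w \<in> W}"
    have "open ?L"
      using openin_continuous_map_preimage[OF continuous_map_line W(2)] by simp
    moreover have "0 \<in> ?L" using W by simp
    \<comment> \<open>A nonempty open set of complex numbers is infinite and therefore not contained
      in the finite set \<open>S\<close>.\<close>
    ultimately have "infinite ?L" using finite_imp_not_open by blast
    then obtain t where t: "t \<in> ?L" "t \<notin> S"
      using finite_singular_shifts[OF A(1)] unfolding S_def[symmetric]
      by (meson finite_subset subsetI)
    define X where "X v = A v + scale t v" for v
    have X: "X \<in> commuting"
      unfolding X_def by (intro commuting_add commuting_scale commuting_ident A)
    have "bij X" by (rule commuting_inverse[OF X]) (use t(2) in \<open>auto simp: X_def S_def\<close>)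
    then have "X w \<in> group_orbit w" unfolding in_group_orbit_iff using X by blast
    moreover have "X w \<in> W" using t(1) by (simp add: X_def A)
    ultimately show ?thesis by blast
  qed
  then show "u \<in> vector_topology scale closure_of group_orbit w"
    by (auto simp: in_closure_of topspace_vector_topology)
qed

text \<open>The kernel of a linear functional is closed, by the choice of the topology.\<close>

lemma functional_vanishes_on_closure:
  assumes f: "Vector_Spaces.linear scale (*) f" and 0: "\<And>u. u \<in> S \<Longrightarrow> f u = 0"
    and u: "u \<in> vector_topology scale closure_of S"
  shows "f u = 0"
proof -
  have "closedin (vector_topology scale) (f -` {0})"
    unfolding closedin_def topspace_vector_topology
    using openin_vector_topology[OF f open_Compl[OF closed_singleton[of 0]]]
    by (simp add: vimage_Diff Compl_eq_Diff_UNIV)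
  then have "vector_topology scale closure_of S \<subseteq> f -` {0}"
    by (rule closure_of_minimal[rotated]) (auto simp: 0)
  then show ?thesis using u by auto
qed

text \<open>The functional in the hypothesis excludes an unreachable \<open>v\<close> from the
  closure of the orbit of \<open>w\<close>; conversely, that closure contains all of
  \<open>reach w\<close>.\<close>

lemma closure_group_orbit_subset_iff:
  assumes "v \<notin> reach w \<Longrightarrow>
    \<exists>f. Vector_Spaces.linear scale (*) f \<and> f v \<noteq> 0 \<and> (\<forall>u\<in>reach w. f u = 0)"
  shows "vector_topology scale closure_of group_orbit v \<subseteq> vector_topology scale closure_of group_orbit w
    \<longleftrightarrow> v \<in> reach w"
proof
  assume sub: "vector_topology scale closure_of group_orbit v
    \<subseteq> vector_topology scale closure_of group_orbit w"
  have "v \<in> vector_topology scale closure_of group_orbit v"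
    using closure_of_subset[of "group_orbit v" "vector_topology scale"] group_orbit_refl
    by (auto simp: topspace_vector_topology)
  then have v: "v \<in> vector_topology scale closure_of group_orbit w" using sub by blast
  show "v \<in> reach w"
  proof (rule ccontr)
    assume "v \<notin> reach w"
    then obtain f where f: "Vector_Spaces.linear scale (*) f" "f v \<noteq> 0" "\<forall>u\<in>reach w. f u = 0"
      using assms by blast
    then show False
      using functional_vanishes_on_closure[OF f(1) _ v] group_orbit_subset_reach by blast
  qed
next
  assume "v \<in> reach w"
  then have "group_orbit v \<subseteq> reach w" using group_orbit_subset_reach reach_trans by blast
  then show "vector_topology scale closure_of group_orbit v
      \<subseteq> vector_topology scale closure_of group_orbit w"
    using reach_subset_closure by (intro closure_of_minimal) (auto simp: closedin_closure_of)
qed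

end

section \<open>Jordan chains from a Jordan normal form\<close>

text \<open>Jordan blocks have their ones above the diagonal, so a chain runs through its block
  backwards.\<close>

fun chain_index :: "(nat \<times> 'a) list \<Rightarrow> nat \<Rightarrow> nat \<Rightarrow> nat" where
  "chain_index [] j a = 0"
| "chain_index ((n, l) # ns) j a = (case j of 0 \<Rightarrow> n - 1 - a | Suc i \<Rightarrow> n + chain_index ns i a)"

lemma chain_index_less:
  "j < length ns \<Longrightarrow> a < fst (ns ! j) \<Longrightarrow> chain_index ns j a < sum_list (map fst ns)"
  by (induction ns j a rule: chain_index.induct) (auto split: nat.splits)

lemma chain_index_eq_iff:
  "\<lbrakk>i < length ns; c < fst (ns ! i); j < length ns; a < fst (ns ! j)\<rbrakk> \<Longrightarrow>
    chain_index ns i c = chain_index ns j a \<longleftrightarrow> i = j \<and> c = a"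
proof (induction ns arbitrary: i j)
  case (Cons nl ns)
  then show ?case by (cases nl) (auto split: nat.splits)
qed simp

text \<open>For passing from sums over matrix indices to sums over chains; each block is summed in
  reverse.\<close>

lemma sum_chain_index:
  fixes f :: "nat \<Rightarrow> 'b::comm_monoid_add"
  shows "(\<Sum>k<sum_list (map fst ns). f k) = (\<Sum>j<length ns. \<Sum>a<fst (ns ! j). f (chain_index ns j a))"
proof (induction ns arbitrary: f)
  case (Cons nl ns)
  obtain n l where nl: "nl = (n, l)" by force
  have split: "(\<Sum>k<n + m. f k) = (\<Sum>k<n. f k) + (\<Sum>k<m. f (n + k))" for m
    by (induction m) (simp_all add: add.assoc)
  have "(\<Sum>k<n. f k) = (\<Sum>a<n. f (n - 1 - a))"
    using sum.nat_diff_reindex[of f n] by simp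
  then show ?case by (simp add: nl split Cons.IH sum.lessThan_Suc_shift del: sum.lessThan_Suc)
qed simp

text \<open>Positions \<open>c\<close> and \<open>a\<close> are row \<open>n - 1 - c\<close> and
  column \<open>n - 1 - a\<close> of a block of size \<open>n\<close>, so the ones above the
  diagonal sit at \<open>c = Suc a\<close>. Different chains meet in a zero block.\<close>

lemma jordan_matrix_chain_index:
  fixes ns :: "(nat \<times> 'a::{zero,one}) list"
  assumes "i < length ns" "c < fst (ns ! i)" "j < length ns" "a < fst (ns ! j)"
  shows "jordan_matrix ns $$ (chain_index ns i c, chain_index ns j a) =
    (if i = j then if c = a then snd (ns ! j) else if c = Suc a then 1 else 0 else 0)"
  using assms
proof (induction ns arbitrary: i j)
  case (Cons nl ns)
  obtain n l where nl: "nl = (n, l)" by force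
  have less: "chain_index ns k d < sum_list (map fst ns)" if "k < length ns" "d < fst (ns ! k)" for k d
    using chain_index_less[OF that] .
  show ?case
    unfolding nl jordan_matrix_Cons
    using Cons less by (auto simp: nl jordan_block_def split: nat.splits)
qed simp

section \<open>Change to a Jordan basis\<close>

text \<open>Write the similarity as \<open>A P = P J\<close>. The columns of \<open>P\<close> define
  a basis \<open>d\<close> in which \<open>T\<close> has the matrix \<open>J\<close>, and the rows
  of \<open>Q\<close> compute the coordinates \<open>y\<close> in it. Reindexing by
  \<open>chain_index\<close> splits this basis into chains.\<close>

lemma jordan_chains_of_jordan_nf:
  fixes scale :: "complex \<Rightarrow> 'v::ab_group_add \<Rightarrow> 'v"
  assumes "linear_operator scale T" and basis: "ordered_basis scale bs"
    and jnf: "jordan_nf (operator_mat scale bs T) ns"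
  shows "\<exists>b x. jordan_chains scale T (length ns) (\<lambda>j. fst (ns ! j)) (\<lambda>j. snd (ns ! j)) b x"
proof -
  interpret linear_operator scale T by fact
  define n where "n = length bs"
  define A where "A = operator_mat scale bs T"
  define J where "J = jordan_matrix ns"
  define r where "r v i = representation (set bs) v (bs ! i)" for v i
  have dist: "distinct bs" and ind: "independent (set bs)" and span: "span (set bs) = UNIV"
    using basis by (auto simp: ordered_basis_def)
  have in_span: "v \<in> span (set bs)" for v using span by simp
  have A_dim: "A \<in> carrier_mat n n" by (simp add: A_def operator_mat_def n_def)
  have A_entry: "A $$ (i, j) = r (T (bs ! j)) i" if "i < n" "j < n" for i j
    using that by (simp add: A_def operator_mat_def n_def r_def)
  have r_add: "r (v + w) i = r v i + r w i" and r_scale: "r (scale c v) i = c * r v i" for v w c i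
    by (simp_all add: r_def representation_add[OF ind in_span in_span]
        representation_scale[OF ind in_span])
  have r_zero: "r 0 i = 0" for i using r_scale[of 0 0 i] by simp
  have r_sum: "r (sum f K) i = (\<Sum>k\<in>K. r (f k) i)" for f i and K :: "nat set"
    by (induction K rule: infinite_finite_induct) (auto simp: r_add r_zero)
  have r_basis: "r (bs ! j) i = (if i = j then 1 else 0)" if "i < n" "j < n" for i j
    using that dist by (simp add: r_def representation_basis[OF ind] n_def nth_eq_iff_index_eq)
  have bij: "bij_betw (\<lambda>i. bs ! i) {..<n} (set bs)"
    using bij_betw_nth[OF dist] by (simp add: n_def)
  have r_expand: "v = (\<Sum>i<n. scale (r v i) (bs ! i))" for v
    using sum_representation_eq[OF ind in_span, of "set bs" v]
      sum.reindex_bij_betw[OF bij, of "\<lambda>w. scale (representation (set bs) v w) w"]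
    by (simp add: r_def)
  obtain P Q where PQ: "P \<in> carrier_mat n n" "Q \<in> carrier_mat n n" and J_dim: "J \<in> carrier_mat n n"
    and PQ1: "P * Q = 1\<^sub>m n" and QP1: "Q * P = 1\<^sub>m n" and AP: "A * P = P * J"
  proof -
    have "similar_mat A J" using jnf by (simp add: jordan_nf_def A_def J_def)
    then obtain n' P Q where dims: "{A, J, P, Q} \<subseteq> carrier_mat n' n'"
      and inv: "P * Q = 1\<^sub>m n'" "Q * P = 1\<^sub>m n'" and A: "A = P * J * Q"
      by (blast dest: similar_matD)
    from dims have "A \<in> carrier_mat n' n'" by blast
    then have "n' = n" using carrier_matD(1) A_dim by blast
    then have dims: "A \<in> carrier_mat n n" "J \<in> carrier_mat n n" "P \<in> carrier_mat n n" "Q \<in> carrier_mat n n"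
      and inv: "P * Q = 1\<^sub>m n" "Q * P = 1\<^sub>m n" using dims inv by blast+
    have "A * P = (P * J) * (Q * P)"
      unfolding A using dims by (intro assoc_mult_mat[of _ n n _ n _ n]) auto
    also have "\<dots> = P * J" using dims inv by (simp add: right_mult_one_mat[of "P * J" n n])
    finally show ?thesis using that dims inv by blast
  qed
  have mult: "(M * N) $$ (i, j) = (\<Sum>k<n. M $$ (i, k) * N $$ (k, j))"
    if "M \<in> carrier_mat n n" "N \<in> carrier_mat n n" "i < n" "j < n" for M N :: "complex mat" and i j
  proof -
    note [simp] = carrier_matD[OF that(1)] carrier_matD[OF that(2)]
    show ?thesis using that(3,4) by (simp add: scalar_prod_def atLeast0LessThan)
  qed
  have n: "n = sum_list (map fst ns)" using carrier_matD(1)[OF J_dim] by (simp add: J_def)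
  define d where "d k = (\<Sum>i<n. scale (P $$ (i, k)) (bs ! i))" for k
  define y where "y v k = (\<Sum>i<n. Q $$ (k, i) * r v i)" for v k
  have r_d: "r (d k) i = P $$ (i, k)" if "i < n" for i k
    using that by (simp add: d_def r_sum r_scale r_basis if_distrib cong: if_cong)
  have y_d: "y (d k) l = (if k = l then 1 else 0)" if "k < n" "l < n" for k l
  proof -
    have "y (d k) l = (Q * P) $$ (l, k)"
      using that by (simp add: mult[OF PQ(2,1)] y_def r_d del: index_mult_mat)
    then show ?thesis using that by (auto simp: QP1)
  qed
  \<comment> \<open>This expresses \<open>P * Q = 1\<close>, just as \<open>y_d\<close> expresses
    \<open>Q * P = 1\<close>.\<close>
  have y_expand: "v = (\<Sum>k<n. scale (y v k) (d k))" for v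
  proof -
    have "(\<Sum>k<n. scale (y v k) (d k))
        = (\<Sum>k<n. \<Sum>j<n. \<Sum>i<n. scale (P $$ (j, k) * Q $$ (k, i) * r v i) (bs ! j))"
      by (simp add: y_def d_def scale_sum_right scale_sum_left sum_distrib_left sum_distrib_right
          mult.assoc mult.commute mult.left_commute)
    also have "\<dots> = (\<Sum>j<n. \<Sum>i<n. \<Sum>k<n. scale (P $$ (j, k) * Q $$ (k, i) * r v i) (bs ! j))"
      by (subst sum.swap) (intro sum.cong refl sum.swap)
    also have "\<dots> = (\<Sum>j<n. \<Sum>i<n. scale ((P * Q) $$ (j, i) * r v i) (bs ! j))"
      by (intro sum.cong refl)
        (simp add: mult[OF PQ] sum_distrib_right scale_sum_left del: index_mult_mat)
    also have "\<dots> = (\<Sum>j<n. scale (r v j) (bs ! j))"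
      by (intro sum.cong refl) (simp add: PQ1 if_distrib if_distribR scale_sum_left[symmetric] cong: if_cong)
    finally show ?thesis using r_expand by simp
  qed
  \<comment> \<open>Column \<open>k\<close> of \<open>A P = P J\<close>, read in the basis
    \<open>bs\<close>.\<close>
  have T_d: "T (d k) = (\<Sum>l<n. scale (J $$ (l, k)) (d l))" if k: "k < n" for k
  proof -
    have "T (d k) = (\<Sum>j<n. scale (P $$ (j, k)) (T (bs ! j)))"
      by (simp add: d_def linearD[OF linear_T])
    also have "\<dots> = (\<Sum>j<n. \<Sum>i<n. scale (A $$ (i, j) * P $$ (j, k)) (bs ! i))"
    proof (intro sum.cong refl)
      fix j assume j: "j \<in> {..<n}"
      have "scale (P $$ (j, k)) (T (bs ! j))
          = scale (P $$ (j, k)) (\<Sum>i<n. scale (r (T (bs ! j)) i) (bs ! i))"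
        using r_expand[of "T (bs ! j)"] by simp
      also have "\<dots> = (\<Sum>i<n. scale (A $$ (i, j) * P $$ (j, k)) (bs ! i))"
        unfolding scale_sum_right using j by (intro sum.cong) (auto simp: A_entry mult.commute)
      finally show "scale (P $$ (j, k)) (T (bs ! j))
          = (\<Sum>i<n. scale (A $$ (i, j) * P $$ (j, k)) (bs ! i))" .
    qed
    also have "\<dots> = (\<Sum>i<n. scale ((A * P) $$ (i, k)) (bs ! i))"
      by (subst sum.swap)
        (intro sum.cong refl, simp add: mult[OF A_dim PQ(1)] k scale_sum_left del: index_mult_mat)
    also have "\<dots> = (\<Sum>i<n. \<Sum>l<n. scale (P $$ (i, l) * J $$ (l, k)) (bs ! i))"
      unfolding AP
      by (intro sum.cong refl) (simp add: mult[OF PQ(1) J_dim] k scale_sum_left del: index_mult_mat)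
    also have "\<dots> = (\<Sum>l<n. scale (J $$ (l, k)) (d l))"
      by (subst sum.swap) (simp add: d_def scale_sum_right mult.commute)
    finally show ?thesis .
  qed
  define g where "g = chain_index ns"
  \<comment> \<open>The value 0 past the end makes the relation for \<open>T (b j a)\<close> hold at
    the last vector of a chain, too.\<close>
  define b where "b j a = (if a < fst (ns ! j) then d (g j a) else 0)" for j a
  have g_less: "g j a < n" if "j < length ns" "a < fst (ns ! j)" for j a
    using chain_index_less[OF that] by (simp add: g_def n)
  have "jordan_chains scale T (length ns) (\<lambda>j. fst (ns ! j)) (\<lambda>j. snd (ns ! j)) b (\<lambda>v j a. y v (g j a))"
  proof
    fix v w c j a
    show "y (v + w) (g j a) = y v (g j a) + y w (g j a)"
      by (simp add: y_def r_add distrib_left sum.distrib)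
    show "y (scale c v) (g j a) = c * y v (g j a)"
      by (simp add: y_def r_scale sum_distrib_left mult.left_commute)
  next
    fix i e j a
    assume "i < length ns" "e < fst (ns ! i)" "j < length ns" "a < fst (ns ! j)"
    then show "y (b i e) (g j a) = (if i = j \<and> e = a then 1 else 0)"
      using g_less chain_index_eq_iff[of i ns e j a] by (simp add: b_def y_d g_def)
  next
    fix v
    show "v = (\<Sum>j<length ns. \<Sum>a<fst (ns ! j). scale (y v (g j a)) (b j a))"
      using y_expand[of v] sum_chain_index[of "\<lambda>k. scale (y v k) (d k)" ns]
      by (simp add: b_def g_def n)
  next
    fix j a assume j: "j < length ns" "a < fst (ns ! j)"
    have "T (b j a) = (\<Sum>l<n. scale (J $$ (l, g j a)) (d l))"
      using j T_d[OF g_less[OF j]] by (simp add: b_def)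
    also have "\<dots> = (\<Sum>i<length ns. \<Sum>c<fst (ns ! i). scale (J $$ (g i c, g j a)) (d (g i c)))"
      using sum_chain_index[of "\<lambda>l. scale (J $$ (l, g j a)) (d l)" ns] by (simp add: n g_def)
    also have "\<dots> = (\<Sum>i<length ns. if i = j then
        \<Sum>c<fst (ns ! j). scale (if c = a then snd (ns ! j) else if c = Suc a then 1 else 0) (d (g j c))
        else 0)"
      using j by (intro sum.cong refl) (auto simp: J_def g_def jordan_matrix_chain_index intro!: sum.cong)
    also have "\<dots> = (\<Sum>c<fst (ns ! j).
        scale (if c = a then snd (ns ! j) else if c = Suc a then 1 else 0) (d (g j c)))"
      using j by simp
    also have "\<dots> = (\<Sum>c<fst (ns ! j). (if c = a then scale (snd (ns ! j)) (d (g j c)) else 0)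
        + (if c = Suc a then d (g j c) else 0))"
      by (intro sum.cong) auto
    also have "\<dots> = scale (snd (ns ! j)) (b j a) + b j (Suc a)"
      using j by (simp add: sum.distrib b_def)
    finally show "T (b j a) = scale (snd (ns ! j)) (b j a) + b j (Suc a)" .
  next
    fix j a assume "j < length ns" "fst (ns ! j) \<le> a"
    then show "b j a = 0" by (simp add: b_def)
  next
    fix j assume "j < length ns"
    then show "0 < fst (ns ! j)"
      using jnf by (auto simp: jordan_nf_def dest!: nth_mem intro!: gr0I)
  qed
  then show ?thesis by blast
qed

section \<open>The lattice of orbits\<close>

text \<open>Prepares the hypotheses of \<open>realizable_depth\<close>: each summand is at most a
  difference of consecutive entries of \<open>ms\<close>, and these differences telescope.\<close>

lemma Gamma_increments_sums:
  fixes ms :: "nat list"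
  assumes ms: "sorted ms" and r: "r \<in> carrier (Gamma_order (increments ms))" and l: "l < length ms"
  shows "(\<Sum>i\<le>l. r i) \<le> ms ! l"
    and "k \<le> l \<Longrightarrow> (\<Sum>i\<le>k. r i) \<le> (\<Sum>i\<le>l. r i)"
    and "k \<le> l \<Longrightarrow> (\<Sum>i\<le>l. r i) \<le> (\<Sum>i\<le>k. r i) + (ms ! l - ms ! k)"
proof -
  have r_nth: "r i \<le> increments ms ! i" if "i < length ms" for i
    using r that by (auto simp: Gamma_order_def PiE_iff increments_def simp del: nth_map)
  have r_le: "r 0 \<le> ms ! 0" if "0 < length ms"
    using r_nth[OF that] that by (simp add: increments_def)
  have r_Suc: "r (Suc i) \<le> ms ! Suc i - ms ! i" if "Suc i < length ms" for i
    using r_nth[OF that] that by (simp add: increments_def)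
  have mono: "ms ! i \<le> ms ! j" if "i \<le> j" "j < length ms" for i j
    using sorted_nth_mono[OF ms that] .
  show "(\<Sum>i\<le>l. r i) \<le> ms ! l"
    using l
  proof (induction l)
    case (Suc l)
    then show ?case using r_Suc[OF Suc.prems] mono[of l "Suc l"] by simp
  qed (use r_le in simp)
  show "(\<Sum>i\<le>k. r i) \<le> (\<Sum>i\<le>l. r i)" if "k \<le> l"
    using that by (intro sum_mono2) auto
  show "(\<Sum>i\<le>l. r i) \<le> (\<Sum>i\<le>k. r i) + (ms ! l - ms ! k)" if "k \<le> l"
    using that l
  proof (induction l rule: dec_induct)
    case (step l)
    then show ?case using r_Suc[of l] mono[of l "Suc l"] mono[of k l] by simp
  qed simp
qed

text \<open>Every Jordan form of \<open>T\<close> yields its own system of chains, and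
  \<open>chain_of_length_iff\<close> describes the lengths in each of them by depths, which depend
  only on \<open>T\<close>.\<close>

lemma jordan_block_sizes_eq:
  fixes scale :: "complex \<Rightarrow> 'v::ab_group_add \<Rightarrow> 'v"
  assumes chains: "jordan_chains scale T q len ev b x"
    and nf: "ordered_basis scale bs" "jordan_nf (operator_mat scale bs T) ns"
  shows "jordan_block_sizes scale T \<mu> = {m. \<exists>j<q. len j = m \<and> ev j = \<mu>}"
proof -
  interpret jordan_chains scale T q len ev b x by (rule chains)
  have *: "(m, \<mu>) \<in> set ns' \<longleftrightarrow> (\<exists>j<q. len j = m \<and> ev j = \<mu>)"
    if nf': "ordered_basis scale bs'" "jordan_nf (operator_mat scale bs' T) ns'" for m bs' ns'
  proof -
    obtain b' x' where "jordan_chains scale T (length ns') (\<lambda>j. fst (ns' ! j)) (\<lambda>j. snd (ns' ! j)) b' x'"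
      using jordan_chains_of_jordan_nf[OF linear_operator_axioms nf'] by blast
    then interpret ch: jordan_chains scale T "length ns'" "\<lambda>j. fst (ns' ! j)" "\<lambda>j. snd (ns' ! j)" b' x' .
    have "(m, \<mu>) \<in> set ns' \<longleftrightarrow> (\<exists>j<length ns'. fst (ns' ! j) = m \<and> snd (ns' ! j) = \<mu>)"
      by (auto simp: in_set_conv_nth prod_eq_iff)
    then show ?thesis using ch.chain_of_length_iff chain_of_length_iff by simp
  qed
  show ?thesis using * nf unfolding jordan_block_sizes_def by blast
qed

context complex_operator
begin

lemma jordan_nf_basis_exists:
  "\<exists>bs ns. ordered_basis scale bs \<and> jordan_nf (operator_mat scale bs T) ns"
proof -
  obtain bs where "set bs = Basis" "distinct bs" using finite_distinct_list[OF finite_Basis] by blast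
  then have basis: "ordered_basis scale bs"
    using independent_Basis span_Basis by (simp add: ordered_basis_def)
  have dim: "operator_mat scale bs T \<in> carrier_mat (length bs) (length bs)"
    by (simp add: operator_mat_def)
  obtain as where "char_poly (operator_mat scale bs T) = (\<Prod>a\<leftarrow>as. [:- a, 1:])"
    using char_poly_factorized[OF dim] by blast
  then show ?thesis using jordan_nf_exists[OF dim] basis by blast
qed

section \<open>The isomorphism\<close>

text \<open>The isomorphism on representatives of orbits: the partial sums of the component at
  \<open>\<mu>\<close> are the depths at the block sizes in increasing order.\<close>

definition profile :: "'v \<Rightarrow> complex \<Rightarrow> nat \<Rightarrow> nat" where
  "profile v = (\<lambda>\<mu>\<in>operator_spectrum scale T. steps (length (block_increments scale T \<mu>))
     (\<lambda>k. depth \<mu> (sorted_list_of_set (jordan_block_sizes scale T \<mu>) ! k) v))"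

lemma lattice_isomorphic_orbit_lattice:
  "lattice_isomorphic (orbit_lattice scale T)
     (product_gorder (operator_spectrum scale T) (\<lambda>\<mu>. Gamma_order (block_increments scale T \<mu>)))"
proof -
  obtain bs ns where nf: "ordered_basis scale bs" "jordan_nf (operator_mat scale bs T) ns"
    using jordan_nf_basis_exists by blast
  obtain b x where "jordan_chains scale T (length ns) (\<lambda>j. fst (ns ! j)) (\<lambda>j. snd (ns ! j)) b x"
    using jordan_chains_of_jordan_nf[OF linear_operator_axioms nf] by blast
  then obtain q len ev where chains: "jordan_chains scale T q len ev b x" by blast
  interpret jordan_chains scale T q len ev b x by (rule chains)
  let ?M = "product_gorder (operator_spectrum scale T) (\<lambda>\<mu>. Gamma_order (block_increments scale T \<mu>))"
  define \<Lambda> where "\<Lambda> = operator_spectrum scale T"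
  define ms where "ms \<mu> = sorted_list_of_set (jordan_block_sizes scale T \<mu>)" for \<mu>
  have sizes: "jordan_block_sizes scale T \<mu> = {m. \<exists>j<q. len j = m \<and> ev j = \<mu>}" for \<mu>
    by (rule jordan_block_sizes_eq[OF chains nf])
  have "finite (jordan_block_sizes scale T \<mu>)" for \<mu>
    by (rule finite_subset[of _ "len ` {..<q}"]) (auto simp: sizes)
  then have set_ms: "set (ms \<mu>) = {m. \<exists>j<q. len j = m \<and> ev j = \<mu>}" for \<mu>
    by (simp add: ms_def sizes)
  have sorted_ms: "sorted (ms \<mu>)" and distinct_ms: "distinct (ms \<mu>)" for \<mu>
    by (simp_all add: ms_def)
  have incr: "block_increments scale T \<mu> = increments (ms \<mu>)" for \<mu>
    by (simp add: block_increments_def ms_def)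
  have ev_\<Lambda>: "ev j \<in> \<Lambda>" if "j < q" for j
    using ev_in_spectrum[OF that] by (auto simp: \<Lambda>_def operator_spectrum_def)
  have profile: "profile v \<mu> = steps (length (ms \<mu>)) (\<lambda>k. depth \<mu> (ms \<mu> ! k) v)"
    if "\<mu> \<in> \<Lambda>" for v \<mu>
    using that by (simp add: profile_def \<Lambda>_def incr ms_def increments_def)
  have mono: "ms \<mu> ! k \<le> ms \<mu> ! Suc k" if "Suc k < length (ms \<mu>)" for \<mu> k
    using sorted_nth_mono[OF sorted_ms, of k "Suc k"] that by simp
  have profile_carrier: "profile v \<in> carrier ?M" for v
  proof -
    have "steps (length (increments (ms \<mu>))) (\<lambda>k. depth \<mu> (ms \<mu> ! k) v)
        \<in> carrier (Gamma_order (increments (ms \<mu>)))" for \<mu>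
    \<comment> \<open>\<open>depth_le_self\<close> bounds the first entry,
      \<open>depth_add_le\<close> the later ones.\<close>
    proof (rule steps_in_Gamma)
      show "depth \<mu> (ms \<mu> ! 0) v \<le> increments (ms \<mu>) ! 0" if "increments (ms \<mu>) \<noteq> []"
        using that by (simp add: increments_def depth_le_self)
      show "depth \<mu> (ms \<mu> ! Suc k) v \<le> depth \<mu> (ms \<mu> ! k) v + increments (ms \<mu>) ! Suc k"
        if "Suc k < length (increments (ms \<mu>))" for k
        using that mono[of k \<mu>] depth_add_le[of \<mu> "ms \<mu> ! k" "ms \<mu> ! Suc k - ms \<mu> ! k" v]
        by (simp add: increments_def)
    qed
    then show ?thesis
      by (auto simp: product_gorder_def profile_def incr ms_def PiE_iff)
  qed
  have sums: "(\<Sum>i\<le>k. profile v \<mu> i) = depth \<mu> (ms \<mu> ! k) v"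
    if "\<mu> \<in> \<Lambda>" "k < length (ms \<mu>)" for v \<mu> k
    unfolding profile[OF that(1)] using that(2) by (intro sum_steps depth_mono mono)
  have le_iff: "profile v \<sqsubseteq>\<^bsub>?M\<^esub> profile w \<longleftrightarrow> v \<in> reach w" for v w
  proof -
    have "profile v \<sqsubseteq>\<^bsub>?M\<^esub> profile w \<longleftrightarrow>
        (\<forall>\<mu>\<in>\<Lambda>. \<forall>k<length (ms \<mu>). depth \<mu> (ms \<mu> ! k) v \<le> depth \<mu> (ms \<mu> ! k) w)"
      by (simp add: product_gorder_def Gamma_order_def incr \<Lambda>_def[symmetric] sums)
        (simp add: increments_def sums)
    also have "\<dots> \<longleftrightarrow> v \<in> reach w"
    proof
      assume le: "\<forall>\<mu>\<in>\<Lambda>. \<forall>k<length (ms \<mu>). depth \<mu> (ms \<mu> ! k) v \<le> depth \<mu> (ms \<mu> ! k) w"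
      show "v \<in> reach w"
      proof (rule reachable_if_depth_le)
        fix j assume j: "j < q"
        then have "len j \<in> set (ms (ev j))" using set_ms by blast
        then obtain k where "k < length (ms (ev j))" "ms (ev j) ! k = len j"
          by (auto simp: in_set_conv_nth)
        then show "depth (ev j) (len j) v \<le> depth (ev j) (len j) w"
          using le ev_\<Lambda>[OF j] by metis
      qed
    qed (auto intro: depth_reach_le)
    finally show ?thesis .
  qed
  have surj: "g \<in> range profile" if g: "g \<in> carrier ?M" for g
  proof -
    have gG: "g \<mu> \<in> carrier (Gamma_order (increments (ms \<mu>)))" if "\<mu> \<in> \<Lambda>" for \<mu>
      using g that by (auto simp: product_gorder_def incr \<Lambda>_def PiE_iff)
    \<comment> \<open>\<open>realizable_depth\<close> expects a function of the size rather than of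
      its index, so the partial sums of \<open>g\<close> are extended to every \<open>m\<close> by
      summing over the block sizes up to \<open>m\<close>.\<close>
    define C where "C \<mu> m = (\<Sum>i | i < length (ms \<mu>) \<and> ms \<mu> ! i \<le> m. g \<mu> i)" for \<mu> m
    have C: "C \<mu> (ms \<mu> ! k) = (\<Sum>i\<le>k. g \<mu> i)" if "k < length (ms \<mu>)" for \<mu> k
    proof -
      have "ms \<mu> ! i \<le> ms \<mu> ! k \<longleftrightarrow> i \<le> k" if "i < length (ms \<mu>)" for i
        using that \<open>k < length (ms \<mu>)\<close> sorted_nth_mono[OF sorted_ms, of i k \<mu>]
          sorted_nth_mono[OF sorted_ms, of k i \<mu>] nth_eq_iff_index_eq[OF distinct_ms, of i \<mu> k]
        by (metis le_antisym nat_le_linear)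
      then have "{i. i < length (ms \<mu>) \<and> ms \<mu> ! i \<le> ms \<mu> ! k} = {..k}"
        using that by auto
      then show ?thesis by (simp add: C_def)
    qed
    have index: "\<exists>k<length (ms (ev j)). len j = ms (ev j) ! k" if "j < q" for j
    proof -
      have "len j \<in> set (ms (ev j))" using set_ms that by blast
      then show ?thesis by (auto simp: in_set_conv_nth)
    qed
    have "\<exists>v. \<forall>j<q. depth (ev j) (len j) v = C (ev j) (len j)"
    proof (rule realizable_depth)
      fix j assume j: "j < q"
      obtain k where "k < length (ms (ev j))" "len j = ms (ev j) ! k" using index[OF j] by blast
      then show "C (ev j) (len j) \<le> len j"
        using C Gamma_increments_sums(1)[OF sorted_ms gG[OF ev_\<Lambda>[OF j]]] by simp
    next
      fix i j assume i: "i < q" and j: "j < q" and eq: "ev i = ev j" and le: "len i \<le> len j"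
      obtain k where k: "k < length (ms (ev j))" "len i = ms (ev j) ! k" using index[OF i] eq by auto
      obtain l where l: "l < length (ms (ev j))" "len j = ms (ev j) ! l" using index[OF j] by blast
      have "k \<le> l"
        using le k l sorted_nth_mono[OF sorted_ms, of l k "ev j"]
          nth_eq_iff_index_eq[OF distinct_ms, of k "ev j" l] by (metis le_antisym nat_le_linear)
      then show "C (ev i) (len i) \<le> C (ev j) (len j) \<and>
          C (ev j) (len j) \<le> C (ev i) (len i) + (len j - len i)"
        using C k l eq Gamma_increments_sums(2,3)[OF sorted_ms gG[OF ev_\<Lambda>[OF j]] l(1)] by simp
    qed
    then obtain v where v: "\<And>j. j < q \<Longrightarrow> depth (ev j) (len j) v = C (ev j) (len j)" by blast
    have "profile v \<mu> = g \<mu>" if \<mu>: "\<mu> \<in> \<Lambda>" for \<mu>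
    proof -
      have "depth \<mu> (ms \<mu> ! k) v = (\<Sum>i\<le>k. g \<mu> i)" if k: "k < length (ms \<mu>)" for k
      proof -
        have "ms \<mu> ! k \<in> set (ms \<mu>)" using k by simp
        then obtain j where "j < q" "len j = ms \<mu> ! k" "ev j = \<mu>" unfolding set_ms by blast
        then show ?thesis using v C[OF k] by metis
      qed
      then have "profile v \<mu> = steps (length (ms \<mu>)) (\<lambda>k. \<Sum>i\<le>k. g \<mu> i)"
        unfolding profile[OF \<mu>] by (intro steps_cong)
      then show ?thesis using Gamma_partial_sums[OF gG[OF \<mu>]] by (simp add: increments_def)
    qed
    moreover have "profile v \<mu> = g \<mu>" if "\<mu> \<notin> \<Lambda>" for \<mu>
      using g that by (auto simp: product_gorder_def profile_def \<Lambda>_def PiE_iff extensional_def)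
    ultimately have "profile v = g" by blast
    then show ?thesis by blast
  qed
  have closure_iff: "vector_topology scale closure_of group_orbit v
      \<subseteq> vector_topology scale closure_of group_orbit w \<longleftrightarrow> v \<in> reach w" for v w
  proof (rule closure_group_orbit_subset_iff)
    assume "v \<notin> reach w"
    then obtain i a where "x v i a \<noteq> 0" "\<forall>u\<in>reach w. x u i a = 0" using separating_coord by blast
    moreover have "Vector_Spaces.linear scale (*) (\<lambda>u. x u i a)"
      by (rule linear_functionalI) (simp_all add: coord_add coord_scale)
    ultimately show "\<exists>f. Vector_Spaces.linear scale (*) f \<and> f v \<noteq> 0 \<and> (\<forall>u\<in>reach w. f u = 0)"
      by blast
  qed
  \<comment> \<open>The choice of a representative does not matter, because vectors of one orbit
    reach each other and so have equal depths.\<close>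
  define F where "F X = profile (SOME v. group_orbit v = X)" for X
  have F: "F (group_orbit v) = profile v" for v
  proof -
    have "group_orbit (SOME w. group_orbit w = group_orbit v) = group_orbit v"
      by (rule someI) (rule refl)
    then have "depth \<mu> m (SOME w. group_orbit w = group_orbit v) = depth \<mu> m v" for \<mu> m
      unfolding group_orbit_eq_iff using depth_reach_le by (meson le_antisym)
    then show ?thesis by (simp add: F_def profile_def)
  qed
  have carrier_L: "carrier (orbit_lattice scale T) = range group_orbit"
    by (auto simp: orbit_lattice_def orbits_def)
  have le_L: "le (orbit_lattice scale T) X Y \<longleftrightarrow>
      vector_topology scale closure_of X \<subseteq> vector_topology scale closure_of Y" for X Y
    by (simp add: orbit_lattice_def)
  show ?thesis
  proof (rule lattice_isomorphicI)
    show "Lattice.lattice ?M" by (intro lattice_product_gorder lattice_Gamma_order)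
    show "X .=\<^bsub>orbit_lattice scale T\<^esub> Y \<longleftrightarrow> X = Y" for X Y by (simp add: orbit_lattice_def)
    show "X \<sqsubseteq>\<^bsub>orbit_lattice scale T\<^esub> Y \<longleftrightarrow> F X \<sqsubseteq>\<^bsub>?M\<^esub> F Y"
      if XY: "X \<in> carrier (orbit_lattice scale T)" "Y \<in> carrier (orbit_lattice scale T)" for X Y
    proof -
      obtain v where v: "X = group_orbit v" using XY(1) unfolding carrier_L by (rule rangeE)
      obtain w where w: "Y = group_orbit w" using XY(2) unfolding carrier_L by (rule rangeE)
      show ?thesis unfolding v w le_L closure_iff F le_iff ..
    qed
    have "inj_on F (range group_orbit)"
    proof (rule inj_onI)
      fix X Y assume XY: "X \<in> range group_orbit" "Y \<in> range group_orbit" "F X = F Y"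
      obtain v where v: "X = group_orbit v" using XY(1) by (rule rangeE)
      obtain w where w: "Y = group_orbit w" using XY(2) by (rule rangeE)
      have eq: "profile v = profile w" using XY(3) unfolding v w F .
      \<comment> \<open>Equal profiles lie below each other, so \<open>le_iff\<close> gives
        reachability in both directions.\<close>
      have "v \<in> reach w" using le_iff[of v v] reach_refl unfolding eq le_iff[symmetric] by simp
      moreover have "w \<in> reach v" using le_iff[of v v] reach_refl unfolding eq le_iff[symmetric] by simp
      ultimately show "X = Y" unfolding v w group_orbit_eq_iff ..
    qed
    moreover have "F ` range group_orbit = carrier ?M"
      using profile_carrier surj by (auto simp: image_image F)
    ultimately show "bij_betw F (carrier (orbit_lattice scale T)) (carrier ?M)"
      unfolding carrier_L bij_betw_def by blast
  qed
qed

end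

theorem theorem5p4:
  fixes smul :: "complex \<Rightarrow> 'v::ab_group_add \<Rightarrow> 'v"
    and Basis :: "'v set"
    and T :: "'v \<Rightarrow> 'v"
  assumes "finite_dimensional_vector_space smul Basis"
    and "Vector_Spaces.linear smul smul T"
  shows "lattice_isomorphic (orbit_lattice smul T)
           (product_gorder (operator_spectrum smul T)
              (\<lambda>\<mu>. Gamma_order (block_increments smul T \<mu>)))"
proof -
  interpret finite_dimensional_vector_space smul Basis by (rule assms(1))
  interpret linear_operator smul T
    by (intro linear_operator.intro linear_operator_axioms.intro vector_space_axioms assms(2))
  interpret complex_operator smul T Basis ..
  show ?thesis by (rule lattice_isomorphic_orbit_lattice)
qed

end
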